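(* Let $n,m\ge1$ with $nm=2$ and let $\varepsilon>0$. For every sequence of balls $\Psi=(B_q)_{q\in\mathbb{N}}$ in $\mathbb{R}^m/\mathbb{Z}^m$, \[ |\mathcal{A}_{n,m}(\Psi)|=1\quad\text{if}\quad\sum_{q=1}^\infty q^{n-1}\Bigl(\frac{\varphi(q)}{q}\Bigr)^{1+\varepsilon}|B_q|=\infty . \]
   Context: $\varphi$ is Euler's totient function. For $\mathbf{q}\in\mathbb{Z}^n$, $|\mathbf{q}|=\max_i|q_i|$. Balls are max-norm balls in $\mathbb{R}^m/\mathbb{Z}^m$; $|\cdot|$ is Lebesgue measure. Points $\mathbf{x}\in[0,1]^{nm}$ are $n\times m$ matrices and $\mathbf{q}\mathbf{x}$ is the row-vector–matrix product. $\mathcal{A}_{n,m}(\Psi)$ is the set of $\mathbf{x}\in[0,1]^{nm}$ such that $\mathbf{q}\mathbf{x}+\mathbf{p}\in B_{|\mathbf{q}|}$ for infinitely many $(\mathbf{p},\mathbf{q})\in\mathbb{Z}^m\times(\mathbb{Z}^n\setminus\{\mathbf0\})$. *)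

theory Defs
  imports "HOL-Analysis.Analysis" "HOL-Number_Theory.Number_Theory"
begin

text \<open>Points of R^m are functions nat => real restricted to {..<m}; n x m real matrices are
functions (nat * nat) => real restricted to {..<n} x {..<m}.  A (max-norm) ball in R^m/Z^m is
given by a centre c (a representative in R^m) and a radius r; it is the set of torus points
whose lifts y satisfy |y_j - c_j - k_j| < r for some k in Z^m.\<close>

definition sup_norm_int :: "nat \<Rightarrow> (nat \<Rightarrow> int) \<Rightarrow> nat" where
  "sup_norm_int n q = nat (Max ((\<lambda>i. \<bar>q i\<bar>) ` {..<n}))"

definition vec_mat :: "nat \<Rightarrow> nat \<Rightarrow> (nat \<Rightarrow> int) \<Rightarrow> (nat \<times> nat \<Rightarrow> real) \<Rightarrow> nat \<Rightarrow> real" where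
  "vec_mat n m q x = (\<lambda>j. if j < m then (\<Sum>i<n. of_int (q i) * x (i, j)) else undefined)"

definition in_torus_ball :: "nat \<Rightarrow> (nat \<Rightarrow> real) \<Rightarrow> real \<Rightarrow> (nat \<Rightarrow> real) \<Rightarrow> bool" where
  "in_torus_ball m c r y \<longleftrightarrow> (\<exists>k::nat \<Rightarrow> int. \<forall>j<m. \<bar>y j - c j - of_int (k j)\<bar> < r)"

definition torus_ball_measure :: "nat \<Rightarrow> (nat \<Rightarrow> real) \<Rightarrow> real \<Rightarrow> real" where
  "torus_ball_measure m c r =
     measure (Pi\<^sub>M {..<m} (\<lambda>_. lborel))
       {y \<in> {..<m} \<rightarrow>\<^sub>E {0..<1}. in_torus_ball m c r y}"

text \<open>A_{n,m}(Psi) for Psi = (B_q), B_q = ball with centre cen q and radius rad q.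
Here the ball is lifted to R^m literally (balls B(c+k, r), k in Z^m), and pairs (p,q) with
q x + p in B_{|q|} are counted.\<close>
definition approx_set :: "nat \<Rightarrow> nat \<Rightarrow> (nat \<Rightarrow> nat \<Rightarrow> real) \<Rightarrow> (nat \<Rightarrow> real) \<Rightarrow> (nat \<times> nat \<Rightarrow> real) set" where
  "approx_set n m cen rad =
     {x \<in> ({..<n} \<times> {..<m}) \<rightarrow>\<^sub>E {0..1}.
        infinite {(p, q). p \<in> {..<m} \<rightarrow>\<^sub>E (UNIV :: int set) \<and> q \<in> {..<n} \<rightarrow>\<^sub>E (UNIV :: int set) \<and>
                          (\<exists>i<n. q i \<noteq> 0) \<and>
                          (\<forall>j<m. \<bar>vec_mat n m q x j + of_int (p j) - cen (sup_norm_int n q) j\<bar>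
                                    < rad (sup_norm_int n q))}}"

end

theory Submission
  imports Defs
begin

text \<open>
  In both cases a second moment bound shows that finitely many of the sets \<open>A\<close> of points solving the
  inequality for a given vector, taken beyond any given height, already cover measure \<open>1 - \<delta>\<close>.

  For \<open>(n, m) = (2, 1)\<close>, the vectors \<open>(q, k)\<close> with \<open>k \<le> q\<close> coprime to \<open>q\<close> give pairwise independent
  events, and \<open>\<Sum> \<phi>(q) |B\<^sub>q| = \<infinity>\<close>.

  For \<open>(n, m) = (1, 2)\<close>, let \<open>a\<^sub>q\<^sup>2 = |B\<^sub>q|\<close>, \<open>q' = q / gcd q r\<close> and \<open>r' = r / gcd q r\<close>. In each coordinate the
  overlap for \<open>q\<close> and \<open>r\<close> is at most \<open>a\<^sub>q a\<^sub>r + e\<close> with \<open>e = min (a\<^sub>q/q') (a\<^sub>r/r')\<close>. Since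
  \<open>e\<^sup>2 \<le> (a\<^sub>q\<^sup>2 + a\<^sub>r\<^sup>2) / (max q' r')\<^sup>2\<close> and \<open>\<Sum>\<^sub>r 1 / (max q' r')\<^sup>2 \<le> 2 \<sigma>(q)/q \<le> 2 q/\<phi>(q)\<close>, on a set
  of \<open>q\<close> with \<open>q/\<phi>(q) \<le> C\<close> and \<open>S = \<Sum> a\<^sub>q\<^sup>2\<close> the total of the \<open>e\<^sup>2\<close> is at most \<open>4 C S\<close>, which is negligible
  against \<open>S\<^sup>2\<close> once \<open>S\<close> is a large multiple of \<open>C\<close>. The factor \<open>(\<phi>(q)/q)\<^bsup>1+\<epsilon>\<^esup>\<close> in the divergence condition
  guarantees that some dyadic class of \<open>q/\<phi>(q)\<close> has this much mass.
\<close>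

section \<open>Arcs on the circle and integrals of 1-periodic functions\<close>

definition circ_ball :: "real \<Rightarrow> real \<Rightarrow> real set" where
  "circ_ball c r = {y. \<exists>k::int. \<bar>y - c - of_int k\<bar> < r}"

text \<open>Length of an arc of radius \<open>r\<close> on the circle. The clipping covers the
  degenerate radii: the arc is empty for \<open>r \<le> 0\<close> and the whole circle for
  \<open>r > 1/2\<close>.\<close>

definition ball_length :: "real \<Rightarrow> real" where
  "ball_length r = max 0 (min 1 (2 * r))"

lemma nn_integral_lborel_shift:
  fixes f :: "real \<Rightarrow> ennreal"
  assumes "f \<in> borel_measurable borel"
  shows "(\<integral>\<^sup>+x. f (x + t) \<partial>lborel) = (\<integral>\<^sup>+x. f x \<partial>lborel)"
  using nn_integral_real_affine[OF assms, of 1 t] by (simp add: add.commute)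

lemma periodic_int:
  fixes f :: "real \<Rightarrow> 'a"
  assumes "\<And>x. f (x + 1) = f x"
  shows "f (x + of_int k) = f x"
proof (induction k arbitrary: x rule: int_induct[where k = 0])
  case (step1 i)
  then show ?case using assms[of "x + of_int i"] by (simp add: add.assoc)
next
  case (step2 i)
  then show ?case using assms[of "x + of_int i - 1"] by (simp add: algebra_simps)
qed simp

text \<open>An integer translation reduces the window to \<open>{s..<s+1}\<close> with
  \<open>s\<close> the fractional part of \<open>t\<close>. The piece beyond 1 then moves back by
  one period and fills \<open>{0..<s}\<close>.\<close>

lemma periodic_nn_integral_window:
  fixes f :: "real \<Rightarrow> ennreal"
  assumes [measurable]: "f \<in> borel_measurable borel" and per: "\<And>x. f (x + 1) = f x"
  shows "(\<integral>\<^sup>+x\<in>{t..<t+1}. f x \<partial>lborel) = (\<integral>\<^sup>+x\<in>{0..<1}. f x \<partial>lborel)"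
proof -
  define s where "s = frac t"
  have s: "0 \<le> s" "s < 1" and t: "t = s + of_int \<lfloor>t\<rfloor>"
    using frac_lt_1[of t] by (auto simp: s_def frac_def)
  have "(\<integral>\<^sup>+x\<in>{t..<t+1}. f x \<partial>lborel)
      = (\<integral>\<^sup>+x. f (x + of_int \<lfloor>t\<rfloor>) * indicator {t..<t+1} (x + of_int \<lfloor>t\<rfloor>) \<partial>lborel)"
    by (subst nn_integral_lborel_shift) auto
  also have "\<dots> = (\<integral>\<^sup>+x\<in>{s..<s+1}. f x \<partial>lborel)"
    using t by (intro nn_integral_cong) (auto simp: periodic_int[of f, OF per] indicator_def)
  also have "\<dots> = (\<integral>\<^sup>+x. f x * indicator {s..<1} x + f x * indicator {1..<s+1} x \<partial>lborel)"
    using s by (intro nn_integral_cong) (auto simp: indicator_def)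
  also have "\<dots> = (\<integral>\<^sup>+x\<in>{s..<1}. f x \<partial>lborel) + (\<integral>\<^sup>+x\<in>{1..<s+1}. f x \<partial>lborel)"
    by (rule nn_integral_add) auto
  also have "(\<integral>\<^sup>+x\<in>{1..<s+1}. f x \<partial>lborel) = (\<integral>\<^sup>+x. f (x + 1) * indicator {1..<s+1} (x + 1) \<partial>lborel)"
    by (subst nn_integral_lborel_shift) auto
  also have "\<dots> = (\<integral>\<^sup>+x\<in>{0..<s}. f x \<partial>lborel)"
    by (intro nn_integral_cong) (auto simp: per indicator_def)
  also have "(\<integral>\<^sup>+x\<in>{s..<1}. f x \<partial>lborel) + (\<integral>\<^sup>+x\<in>{0..<s}. f x \<partial>lborel)
      = (\<integral>\<^sup>+x. f x * indicator {s..<1} x + f x * indicator {0..<s} x \<partial>lborel)"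
    by (rule nn_integral_add[symmetric]) auto
  also have "\<dots> = (\<integral>\<^sup>+x\<in>{0..<1}. f x \<partial>lborel)"
    using s by (intro nn_integral_cong) (auto simp: indicator_def)
  finally show ?thesis .
qed

lemma periodic_nn_integral_shift:
  fixes f :: "real \<Rightarrow> ennreal"
  assumes [measurable]: "f \<in> borel_measurable borel" and per: "\<And>x. f (x + 1) = f x"
  shows "(\<integral>\<^sup>+x\<in>{0..<1}. f (x + t) \<partial>lborel) = (\<integral>\<^sup>+x\<in>{0..<1}. f x \<partial>lborel)"
proof -
  have "(\<integral>\<^sup>+x\<in>{0..<1}. f (x + t) \<partial>lborel) = (\<integral>\<^sup>+x. f (x + t) * indicator {t..<t+1} (x + t) \<partial>lborel)"
    by (intro nn_integral_cong) (auto simp: indicator_def)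
  also have "\<dots> = (\<integral>\<^sup>+x\<in>{t..<t+1}. f x \<partial>lborel)"
    by (subst nn_integral_lborel_shift[where f = "\<lambda>x. f x * indicator {t..<t+1} x"]) auto
  finally show ?thesis using periodic_nn_integral_window[OF assms] by simp
qed

text \<open>The substitution \<open>N * x\<close> runs through \<open>N\<close> consecutive periods,
  which contribute equally. So multiplication by \<open>N\<close> preserves Lebesgue measure on the
  circle.\<close>

lemma periodic_nn_integral_scale:
  fixes f :: "real \<Rightarrow> ennreal"
  assumes [measurable]: "f \<in> borel_measurable borel" and per: "\<And>x. f (x + 1) = f x" and "N > 0"
  shows "(\<integral>\<^sup>+x\<in>{0..<1}. f (real N * x) \<partial>lborel) = (\<integral>\<^sup>+x\<in>{0..<1}. f x \<partial>lborel)"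
proof -
  have *: "(\<integral>\<^sup>+x\<in>{0..<real n}. f x \<partial>lborel) = of_nat n * (\<integral>\<^sup>+x\<in>{0..<1}. f x \<partial>lborel)" for n
  proof (induction n)
    case (Suc n)
    have "(\<integral>\<^sup>+x\<in>{0..<real (Suc n)}. f x \<partial>lborel)
        = (\<integral>\<^sup>+x. f x * indicator {0..<real n} x + f x * indicator {real n..<real n + 1} x \<partial>lborel)"
      by (intro nn_integral_cong) (auto simp: indicator_def)
    also have "\<dots> = (\<integral>\<^sup>+x\<in>{0..<real n}. f x \<partial>lborel) + (\<integral>\<^sup>+x\<in>{real n..<real n + 1}. f x \<partial>lborel)"
      by (rule nn_integral_add) auto
    finally show ?case
      unfolding Suc.IH periodic_nn_integral_window[OF assms(1,2)] by (simp add: algebra_simps)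
  qed simp
  have "of_nat N * (\<integral>\<^sup>+x\<in>{0..<1}. f x \<partial>lborel) = (\<integral>\<^sup>+x\<in>{0..<real N}. f x \<partial>lborel)"
    by (simp add: *)
  also have "\<dots> = of_nat N * (\<integral>\<^sup>+x. f (real N * x) * indicator {0..<real N} (real N * x) \<partial>lborel)"
    using \<open>N > 0\<close> by (subst nn_integral_real_affine[where c = "real N" and t = 0])
      (auto simp: ennreal_of_nat_eq_real_of_nat)
  also have "(\<integral>\<^sup>+x. f (real N * x) * indicator {0..<real N} (real N * x) \<partial>lborel)
      = (\<integral>\<^sup>+x\<in>{0..<1}. f (real N * x) \<partial>lborel)"
    using \<open>N > 0\<close> by (intro nn_integral_cong) (auto simp: indicator_def zero_le_mult_iff)
  finally show ?thesis
    using \<open>N > 0\<close> by (subst (asm) ennreal_mult_cancel_left) auto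
qed

lemma circ_ball_borel [measurable]: "circ_ball c r \<in> sets borel"
proof -
  have "circ_ball c r = (\<Union>k::int. {c + of_int k - r <..< c + of_int k + r})"
    by (auto simp: circ_ball_def abs_less_iff algebra_simps)
  then show ?thesis by auto
qed

lemma circ_ball_shift_int [simp]: "x + of_int k \<in> circ_ball c r \<longleftrightarrow> x \<in> circ_ball c r"
proof
  assume "x + of_int k \<in> circ_ball c r"
  then obtain l :: int where "\<bar>x + of_int k - c - of_int l\<bar> < r" by (auto simp: circ_ball_def)
  then have "\<bar>x - c - of_int (l - k)\<bar> < r" by (simp add: algebra_simps)
  then show "x \<in> circ_ball c r" unfolding circ_ball_def by blast
next
  assume "x \<in> circ_ball c r"
  then obtain l :: int where "\<bar>x - c - of_int l\<bar> < r" by (auto simp: circ_ball_def)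
  then have "\<bar>x + of_int k - c - of_int (l + k)\<bar> < r" by (simp add: algebra_simps)
  then show "x + of_int k \<in> circ_ball c r" unfolding circ_ball_def by blast
qed

lemma circ_ball_length:
  "(\<integral>\<^sup>+x\<in>{0..<1}. indicator (circ_ball c r) x \<partial>lborel) = ennreal (ball_length r)"
proof -
  \<comment> \<open>In the period centred at \<open>c\<close>, an arc with
    \<open>r \<le> 1/2\<close> is a single interval: only the lift with \<open>k = 0\<close> meets
    the window.\<close>
  define t where "t = c - 1/2"
  have "(\<integral>\<^sup>+x\<in>{0..<1}. indicator (circ_ball c r) x \<partial>lborel)
      = (\<integral>\<^sup>+x\<in>{t..<t+1}. indicator (circ_ball c r) x \<partial>lborel)"
    using circ_ball_shift_int[of _ 1]
    by (intro periodic_nn_integral_window[symmetric]) (auto simp: indicator_def)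
  also have "\<dots> = (\<integral>\<^sup>+x. indicator (circ_ball c r \<inter> {t..<t+1}) x \<partial>lborel)"
    by (simp add: indicator_inter_arith)
  also have "\<dots> = emeasure lborel (circ_ball c r \<inter> {t..<t+1})" by simp
  also have "\<dots> = ennreal (ball_length r)"
  proof (cases "r > 1/2")
    case True
    have "circ_ball c r \<inter> {t..<t+1} = {t..<t+1}"
      using True by (auto simp: circ_ball_def t_def abs_less_iff intro!: exI[of _ 0])
    with True show ?thesis by (simp add: ball_length_def)
  next
    case False
    have "circ_ball c r \<inter> {t..<t+1} = {c - r<..<c + r}"
    proof (intro equalityI subsetI)
      fix x assume x: "x \<in> circ_ball c r \<inter> {t..<t+1}"
      then obtain k :: int where k: "\<bar>x - c - of_int k\<bar> < r" by (auto simp: circ_ball_def)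
      with x False have "of_int k < (1::real)" "of_int k > (-1::real)"
        by (auto simp: t_def abs_less_iff)
      then have "k = 0" by linarith
      with k show "x \<in> {c - r<..<c + r}" by (auto simp: abs_less_iff)
    next
      fix x assume "x \<in> {c - r<..<c + r}"
      then show "x \<in> circ_ball c r \<inter> {t..<t+1}" using False
        by (auto simp: circ_ball_def t_def abs_less_iff intro!: exI[of _ 0])
    qed
    then show ?thesis using False by (auto simp: ball_length_def max_def min_def)
  qed
  finally show ?thesis .
qed

section \<open>Divisor sums, gcd sums and integers in an interval\<close>

text \<open>The terms with \<open>s \<le> n\<close> are constant and add up to at most
  \<open>1 / n\<close>. Those beyond \<open>n\<close> are dominated by the telescoping differences
  \<open>1 / (s - 1) - 1 / s\<close>, which add at most another \<open>1 / n\<close>.\<close>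

lemma sum_inverse_max_square_le:
  fixes n M :: nat
  assumes "n > 0"
  shows "(\<Sum>s=1..M. 1 / (real (max n s))\<^sup>2) \<le> 2 / real n"
proof -
  \<comment> \<open>The bound is sharpened for the induction: both branches equal
    \<open>1 / n\<close> at \<open>M = n\<close>, and the term \<open>- 1 / real M\<close> absorbs
    the next telescoping difference.\<close>
  have "(\<Sum>s=1..M. 1 / (real (max n s))\<^sup>2)
      \<le> (if M \<le> n then real M / (real n)\<^sup>2 else 2 / real n - 1 / real M)"
  proof (induction M)
    case (Suc M)
    show ?case
    proof (cases "Suc M \<le> n")
      case True
      then have "max n (Suc M) = n" by simp
      with Suc True show ?thesis by (simp add: add_divide_distrib)
    next
      case False
      then have "M > 0" and max: "max n (Suc M) = Suc M" using assms by simp_all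
      have "(\<Sum>s=1..M. 1 / (real (max n s))\<^sup>2) \<le> 2 / real n - 1 / real M"
      proof (cases "M = n")
        case True
        with Suc assms show ?thesis by (simp add: power2_eq_square)
      next
        case False
        with Suc \<open>\<not> Suc M \<le> n\<close> show ?thesis by simp
      qed
      moreover have "1 / (real (Suc M))\<^sup>2 \<le> 1 / real M - 1 / real (Suc M)"
      proof -
        have "1 / (real (Suc M))\<^sup>2 \<le> 1 / (real M * real (Suc M))"
          using \<open>M > 0\<close> by (intro divide_left_mono) (auto simp: power2_eq_square)
        also have "\<dots> = 1 / real M - 1 / real (Suc M)"
          using \<open>M > 0\<close> by (simp add: field_simps)
        finally show ?thesis .
      qed
      ultimately show ?thesis using False max by simp
    qed
  qed simp
  also have "\<dots> \<le> 2 / real n"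
  proof (cases "M \<le> n")
    case True
    have "real M / (real n)\<^sup>2 \<le> real n / (real n)\<^sup>2" using True by (intro divide_right_mono) auto
    also have "\<dots> \<le> 2 / real n" using assms by (simp add: power2_eq_square field_simps)
    finally show ?thesis using True by simp
  qed simp
  finally show ?thesis .
qed

text \<open>By the product formula, \<open>totient n / n\<close> is the product of
  \<open>1 - 1/p\<close> over the primes dividing \<open>n\<close>. Passing from \<open>d\<close> to
  its multiple \<open>n\<close> only adds factors in the unit interval.\<close>

lemma totient_dvd_ratio_le:
  assumes "d dvd n" "n > 0"
  shows "d * totient n \<le> n * totient d"
proof -
  define P where "P m = (\<Prod>p\<in>prime_factors m. 1 - 1 / real p)" for m :: nat
  have sub: "prime_factors d \<subseteq> prime_factors n"
    using assms by (intro dvd_prime_factors) auto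
  have factor: "0 \<le> 1 - 1 / real p \<and> 1 - 1 / real p \<le> 1" if "p \<in> prime_factors n" for p
    using that prime_gt_0_nat[of p] by (auto simp: in_prime_factors_iff field_simps)
  have "P n = (\<Prod>p\<in>prime_factors n - prime_factors d. 1 - 1 / real p) * P d"
    unfolding P_def using sub by (intro prod.subset_diff) auto
  also have "\<dots> \<le> 1 * P d"
    using factor sub by (intro mult_right_mono prod_le_1) (auto simp: P_def intro!: prod_nonneg)
  finally have "P n \<le> P d" by simp
  then have "real d * (real n * P n) \<le> real n * (real d * P d)"
    by (simp add: mult_left_mono mult.left_commute)
  then have "real (d * totient n) \<le> real (n * totient d)"
    by (simp add: totient_formula2 P_def)
  then show ?thesis by (simp only: of_nat_le_iff)
qed

text \<open>Each \<open>d * totient n\<close> is replaced by the larger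
  \<open>n * totient d\<close>, and the values \<open>totient d\<close> over the divisors of
  \<open>n\<close> sum to \<open>n\<close>. This is the bound
  \<open>\<sigma>(n) \<phi>(n) \<le> n\<^sup>2\<close>.\<close>

lemma sum_divisors_totient_le:
  assumes "n > 0"
  shows "(\<Sum>d | d dvd n. d) * totient n \<le> n\<^sup>2"
proof -
  have "(\<Sum>d | d dvd n. d) * totient n = (\<Sum>d | d dvd n. d * totient n)"
    by (simp add: sum_distrib_right)
  also have "\<dots> \<le> (\<Sum>d | d dvd n. n * totient d)"
    using assms by (intro sum_mono totient_dvd_ratio_le) auto
  also have "\<dots> = n * n"
    by (simp add: sum_distrib_left[symmetric] totient_divisor_sum)
  finally show ?thesis by (simp add: power2_eq_square)
qed

text \<open>Group by \<open>d = gcd q r\<close> and write \<open>r = d * s\<close>. The sum over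
  \<open>s\<close> is handled by \<open>sum_inverse_max_square_le\<close> with
  \<open>n = q div d\<close>, and the resulting bounds \<open>2 * d / q\<close> add up to
  \<open>2 \<sigma>(q) / q\<close>.\<close>

lemma sum_inverse_max_gcd_le:
  fixes F :: "nat set"
  assumes "finite F" "0 \<notin> F" "q > 0"
  shows "(\<Sum>r\<in>F. 1 / (real (max (q div gcd q r) (r div gcd q r)))\<^sup>2) \<le> 2 * (real q / real (totient q))"
proof -
  let ?D = "{d. d dvd q}"
  let ?h = "\<lambda>r. 1 / (real (max (q div gcd q r) (r div gcd q r)))\<^sup>2"
  define M where "M = Max (insert 0 F)"
  have fin: "finite ?D" using assms by simp
  have inner: "sum ?h {r \<in> F. gcd q r = d} \<le> 2 * (real d / real q)" if d: "d dvd q" for d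
  proof -
    let ?R = "{r \<in> F. gcd q r = d}"
    have dpos: "d > 0" using d assms by (metis dvd_pos_nat)
    have dvd: "d dvd r" if "r \<in> ?R" for r using that by auto
    have inj: "inj_on (\<lambda>r. r div d) ?R"
      using dvd by (intro inj_onI) (metis dvd_div_mult_self)
    have "sum ?h ?R = (\<Sum>r\<in>?R. 1 / (real (max (q div d) (r div d)))\<^sup>2)"
      by (intro sum.cong) auto
    also have "\<dots> = (\<Sum>s\<in>(\<lambda>r. r div d) ` ?R. 1 / (real (max (q div d) s))\<^sup>2)"
      by (subst sum.reindex[OF inj]) simp
    also have "\<dots> \<le> (\<Sum>s=1..M. 1 / (real (max (q div d) s))\<^sup>2)"
    proof (intro sum_mono2)
      show "(\<lambda>r. r div d) ` ?R \<subseteq> {1..M}"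
      proof safe
        fix r assume r: "r \<in> F" "d = gcd q r"
        then have "r > 0" using assms by (metis gr0I)
        moreover have "r \<le> M" using r assms by (auto simp: M_def)
        moreover have "r div gcd q r > 0" using \<open>r > 0\<close> by (simp add: div_greater_zero_iff gcd_le2_nat)
        moreover have "r div gcd q r \<le> r" by simp
        ultimately show "r div gcd q r \<in> {1..M}" using le_trans[of "r div gcd q r" r M] by auto
      qed
    qed auto
    also have "\<dots> \<le> 2 / real (q div d)"
      using d dpos assms by (intro sum_inverse_max_square_le) (simp add: div_greater_zero_iff dvd_imp_le)
    also have "\<dots> = 2 * (real d / real q)" using d by (simp add: real_of_nat_div)
    finally show ?thesis .
  qed
  have "(\<Sum>r\<in>F. ?h r) = (\<Sum>d\<in>?D. sum ?h {r \<in> F. gcd q r = d})"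
    using assms fin by (intro sum.group[symmetric]) auto
  also have "\<dots> \<le> (\<Sum>d\<in>?D. 2 * (real d / real q))"
    using inner by (intro sum_mono) auto
  also have "\<dots> = 2 * (real (\<Sum>d\<in>?D. d) / real q)"
    by (simp add: sum_distrib_left sum_divide_distrib)
  also have "real (\<Sum>d\<in>?D. d) / real q \<le> real q / real (totient q)"
  proof -
    have "real ((\<Sum>d\<in>?D. d) * totient q) \<le> real (q\<^sup>2)"
      using sum_divisors_totient_le[OF \<open>q > 0\<close>] by (simp only: of_nat_le_iff)
    then show ?thesis using assms by (simp add: field_simps power2_eq_square)
  qed
  finally show ?thesis by simp
qed

lemma card_ints_in_interval_le:
  fixes u R :: real
  assumes "R \<ge> 0"
  shows "finite {w::int. \<bar>of_int w - u\<bar> < R}" "real (card {w::int. \<bar>of_int w - u\<bar> < R}) \<le> 2 * R + 1"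
proof -
  let ?W = "{w::int. \<bar>of_int w - u\<bar> < R}" and ?I = "{\<lfloor>u - R\<rfloor> + 1..\<lceil>u + R\<rceil> - 1}"
  have sub: "?W \<subseteq> ?I" by (auto simp: abs_less_iff) linarith+
  then show "finite ?W" by (rule finite_subset) simp
  have "card ?W \<le> card ?I" using sub by (intro card_mono) auto
  also have "card ?I = nat (\<lceil>u + R\<rceil> - \<lfloor>u - R\<rfloor> - 1)" by simp
  finally have "real (card ?W) \<le> real (nat (\<lceil>u + R\<rceil> - \<lfloor>u - R\<rfloor> - 1))" by simp
  also have "\<dots> \<le> 2 * R + 1" using assms by linarith
  finally show "real (card ?W) \<le> 2 * R + 1" .
qed

section \<open>Second moments and limsup sets\<close>

lemma second_moment_union_ge:
  assumes "finite F" and fm: "\<And>i. i \<in> F \<Longrightarrow> A i \<in> fmeasurable M"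
    and S: "S = (\<Sum>i\<in>F. measure M (A i))" "S > 0" and "\<delta> \<ge> 0"
    and le: "(\<Sum>i\<in>F. \<Sum>j\<in>F. measure M (A i \<inter> A j)) \<le> (1 + \<delta>) * S\<^sup>2"
  shows "measure M (\<Union>i\<in>F. A i) \<ge> 1 - \<delta>"
proof -
  \<comment> \<open>This \<open>t\<close> maximises
    \<open>2 * t * S - t\<^sup>2 * (1 + \<delta>) * S\<^sup>2\<close>, and the maximum is
    \<open>1 / (1 + \<delta>)\<close>.\<close>
  define t where "t = 1 / ((1 + \<delta>) * S)"
  define f where "f x = (\<Sum>i\<in>F. indicator (A i) x :: real)" for x
  have fm2: "A i \<inter> A j \<in> fmeasurable M" if "i \<in> F" "j \<in> F" for i j
    using fm that by (auto intro: fmeasurable_Int_fmeasurable dest: fmeasurableD)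
  have int: "integrable M (indicator X :: _ \<Rightarrow> real)" "integral\<^sup>L M (indicator X :: _ \<Rightarrow> real) = measure M X"
    if "X \<in> fmeasurable M" for X
    using that by (auto simp: fmeasurable_def Int_absorb2 sets.sets_into_space)
  have f2: "(f x)\<^sup>2 = (\<Sum>i\<in>F. \<Sum>j\<in>F. indicator (A i \<inter> A j) x)" for x
    by (simp add: f_def power2_eq_square sum_product indicator_inter_arith)
  have Un: "(\<Union>i\<in>F. A i) \<in> fmeasurable M"
    using assms by (intro fmeasurable.finite_UN) auto
  have If: "integrable M f" "integral\<^sup>L M f = S"
    unfolding f_def S(1) using fm int by (auto simp: Bochner_Integration.integral_sum)
  have If2: "integrable M (\<lambda>x. (f x)\<^sup>2)" "integral\<^sup>L M (\<lambda>x. (f x)\<^sup>2) = (\<Sum>i\<in>F. \<Sum>j\<in>F. measure M (A i \<inter> A j))"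
    unfolding f2 using fm2 int by (auto simp: Bochner_Integration.integral_sum)
  \<comment> \<open>On the union this is \<open>(1 - t f)\<^sup>2 \<ge> 0\<close>; integrating it with the optimal \<open>t\<close>
    replaces the Cauchy--Schwarz inequality.\<close>
  have pt: "2 * t * f x - t\<^sup>2 * (f x)\<^sup>2 \<le> indicator (\<Union>i\<in>F. A i) x" for x
  proof (cases "x \<in> (\<Union>i\<in>F. A i)")
    case True
    have "0 \<le> (1 - t * f x)\<^sup>2" by simp
    with True show ?thesis by (simp add: power2_eq_square algebra_simps)
  next
    case False
    then have "f x = 0" by (auto simp: f_def intro!: sum.neutral)
    then show ?thesis by simp
  qed
  have "1 - \<delta> \<le> 1 / (1 + \<delta>)" using \<open>\<delta> \<ge> 0\<close> by (simp add: field_simps)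
  also have "\<dots> = 2 * t * S - t\<^sup>2 * ((1 + \<delta>) * S\<^sup>2)"
    using \<open>\<delta> \<ge> 0\<close> \<open>S > 0\<close> by (simp add: t_def divide_simps power2_eq_square)
  also have "\<dots> \<le> 2 * t * S - t\<^sup>2 * (\<Sum>i\<in>F. \<Sum>j\<in>F. measure M (A i \<inter> A j))"
    using le by (intro diff_left_mono mult_left_mono) auto
  also have "\<dots> = integral\<^sup>L M (\<lambda>x. 2 * t * f x - t\<^sup>2 * (f x)\<^sup>2)"
    using If If2 by simp
  also have "\<dots> \<le> integral\<^sup>L M (indicator (\<Union>i\<in>F. A i))"
    using If If2 int[OF Un] pt by (intro integral_mono) auto
  also have "\<dots> = measure M (\<Union>i\<in>F. A i)" using int[OF Un] by simp
  finally show ?thesis .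
qed

text \<open>Letting \<open>\<delta>\<close> tend to 0, the union of the sets of level at least
  \<open>N\<close> fills \<open>\<Omega>\<close> up to a null set, for every \<open>N\<close> at
  once. A point in all these unions lies in infinitely many \<open>A i\<close>, since finitely many
  indices would have a largest level.\<close>

lemma AE_infinitely_often:
  fixes lev :: "'i \<Rightarrow> nat"
  assumes Om: "\<Omega> \<in> fmeasurable M" "measure M \<Omega> = 1" and "countable I"
    and A: "\<And>i. i \<in> I \<Longrightarrow> A i \<in> sets M" "\<And>i. i \<in> I \<Longrightarrow> A i \<subseteq> \<Omega>"
    and ex: "\<And>\<delta> N. \<delta> > 0 \<Longrightarrow>
      \<exists>F. finite F \<and> F \<subseteq> {i \<in> I. lev i \<ge> N} \<and> measure M (\<Union>i\<in>F. A i) \<ge> 1 - \<delta>"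
  shows "AE x in M. x \<in> \<Omega> \<longrightarrow> infinite {i \<in> I. x \<in> A i}"
proof -
  have "AE x in M. x \<in> \<Omega> \<longrightarrow> (\<exists>i\<in>I. lev i \<ge> N \<and> x \<in> A i)" for N
  proof -
    define U where "U = (\<Union>i\<in>{i \<in> I. lev i \<ge> N}. A i)"
    have U: "U \<in> sets M" unfolding U_def using A \<open>countable I\<close> by (intro sets.countable_UN') auto
    have sub: "U \<subseteq> \<Omega>" using A by (auto simp: U_def)
    have Ufm: "U \<in> fmeasurable M" using fmeasurableI2[OF Om(1) sub U] .
    have "measure M U \<ge> 1 - \<delta>" if \<delta>: "\<delta> > 0" for \<delta>
    proof -
      obtain F where F: "finite F" "F \<subseteq> {i \<in> I. lev i \<ge> N}" "measure M (\<Union>i\<in>F. A i) \<ge> 1 - \<delta>"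
        using ex[OF \<delta>] by blast
      have "measure M (\<Union>i\<in>F. A i) \<le> measure M U"
        using F A Ufm by (intro measure_mono_fmeasurable) (auto simp: U_def)
      with F show ?thesis by simp
    qed
    then have "1 \<le> measure M U + \<delta>" if "\<delta> > 0" for \<delta>
      using that by (simp add: diff_le_eq)
    then have "1 \<le> measure M U" by (rule field_le_epsilon)
    then have "measure M (\<Omega> - U) \<le> 0"
      using measurable_measure_Diff[OF Om(1) U sub] Om by simp
    then have "measure M (\<Omega> - U) = 0" by (simp add: measure_le_0_iff)
    moreover have fm: "\<Omega> - U \<in> fmeasurable M" using Om U by (intro fmeasurable_Diff)
    ultimately have "emeasure M (\<Omega> - U) = 0"
      using emeasure_eq_ennreal_measure[of M "\<Omega> - U"] fmeasurableD2[OF fm] by simp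
    then have "\<Omega> - U \<in> null_sets M" using fmeasurableD[OF fm] by (rule null_setsI)
    then show ?thesis
      by (rule AE_I') (auto simp: U_def)
  qed
  then have "AE x in M. \<forall>N. x \<in> \<Omega> \<longrightarrow> (\<exists>i\<in>I. lev i \<ge> N \<and> x \<in> A i)"
    by (subst AE_all_countable) blast
  then show ?thesis
  proof (eventually_elim, safe)
    fix x assume x: "\<forall>N. x \<in> \<Omega> \<longrightarrow> (\<exists>i\<in>I. lev i \<ge> N \<and> x \<in> A i)" "x \<in> \<Omega>"
      and fin: "finite {i \<in> I. x \<in> A i}"
    obtain i where "i \<in> I" "x \<in> A i" "lev i \<ge> Suc (Max (lev ` {i \<in> I. x \<in> A i}))"
      using x by blast
    moreover from this have "lev i \<le> Max (lev ` {i \<in> I. x \<in> A i})"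
      using fin by (intro Max_ge) auto
    ultimately show False by simp
  qed
qed

section \<open>Blocks of large mass in divergent series\<close>

lemma not_summable_tail_unbounded:
  fixes f :: "nat \<Rightarrow> real"
  assumes "\<And>n. f n \<ge> 0" "\<not> summable f"
  shows "\<exists>M. (\<Sum>n=N..<M. f n) \<ge> K"
proof (rule ccontr)
  assume *: "\<not> ?thesis"
  have "summable f"
  proof (rule summableI_nonneg_bounded[where x = "(\<Sum>n<N. f n) + K"])
    fix M
    have "(\<Sum>n<M. f n) \<le> (\<Sum>n\<in>{..<N} \<union> {N..<M}. f n)"
      using assms by (intro sum_mono2) auto
    also have "\<dots> = (\<Sum>n<N. f n) + (\<Sum>n=N..<M. f n)" by (intro sum.union_disjoint) auto
    also have "\<dots> \<le> (\<Sum>n<N. f n) + K" using * by (simp add: not_le less_imp_le)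
    finally show "(\<Sum>n<M. f n) \<le> (\<Sum>n<N. f n) + K" .
  qed (use assms in auto)
  with assms show False by simp
qed

lemma divergent_weighted_sum_class:
  fixes b w :: "nat \<Rightarrow> real"
  assumes b: "\<And>k. b k \<ge> 0" and w: "\<And>k. w k > 0" "\<And>k. w k \<le> 1" and "\<epsilon> > 0" "K > 0"
    and ns: "\<not> summable (\<lambda>k. w k powr (1 + \<epsilon>) * b k)"
  shows "\<exists>C F. C \<ge> 1 \<and> finite F \<and> F \<subseteq> {N..} \<and> (\<forall>k\<in>F. 1 / w k \<le> C) \<and> sum b F \<ge> K * C"
proof (rule ccontr)
  assume neg: "\<not> ?thesis"
  have less: "sum b F < K * C" if "C \<ge> 1" "finite F" "F \<subseteq> {N..}" "\<forall>k\<in>F. 1 / w k \<le> C" for C F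
    using neg that by (meson not_le)
  \<comment> \<open>Dyadic classes of \<open>1 / w\<close>: if none had enough mass, the class \<open>y\<close> would contribute at most a
    constant times \<open>2 powr (- \<epsilon> * y)\<close>.\<close>
  define j where "j k = nat \<lfloor>log 2 (1 / w k)\<rfloor>" for k
  define z where "z = 2 powr (- \<epsilon>)"
  have z: "0 < z" "z < 1" using \<open>\<epsilon> > 0\<close> by (auto simp: z_def powr_less_one)
  have j: "2 ^ j k \<le> 1 / w k" "1 / w k \<le> 2 ^ Suc (j k)" for k
  proof -
    have "log 2 (1 / w k) \<ge> 0" using w[of k] by (simp add: zero_le_log_cancel_iff)
    then have "real (j k) \<le> log 2 (1 / w k)" "log 2 (1 / w k) \<le> real (Suc (j k))"
      by (auto simp: j_def) linarith+
    then show "2 ^ j k \<le> 1 / w k" "1 / w k \<le> 2 ^ Suc (j k)"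
      using w(1)[of k] by (auto simp: le_log_iff log_le_iff powr_realpow simp del: power_Suc of_nat_Suc)
  qed
  have "(\<Sum>k=N..<M. w k powr (1 + \<epsilon>) * b k) \<le> 2 * K * (1 / (1 - z))" for M
  proof -
    have cls: "(\<Sum>k\<in>{k \<in> {N..<M}. j k = y}. w k powr (1 + \<epsilon>) * b k) \<le> 2 * K * z ^ y" for y
    proof -
      let ?F = "{k \<in> {N..<M}. j k = y}"
      \<comment> \<open>The upper end of the dyadic class plays the role of \<open>C\<close> in
        \<open>less\<close>.\<close>
      have "sum b ?F \<le> K * 2 ^ Suc y"
      proof (rule less_imp_le[OF less])
        show "(1::real) \<le> 2 ^ Suc y" by (rule one_le_power) simp
        show "\<forall>k\<in>?F. 1 / w k \<le> 2 ^ Suc y" using j(2) by auto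
      qed auto
      have "(\<Sum>k\<in>?F. w k powr (1 + \<epsilon>) * b k) \<le> (\<Sum>k\<in>?F. (1 / 2 ^ y) powr (1 + \<epsilon>) * b k)"
      proof (intro sum_mono mult_right_mono b powr_mono2)
        fix k assume "k \<in> ?F"
        then show "w k \<le> 1 / 2 ^ y" using j(1)[of k] w(1)[of k] by (auto simp: field_simps)
      qed (use w \<open>\<epsilon> > 0\<close> in \<open>auto intro: less_imp_le\<close>)
      also have "\<dots> = (1 / 2 ^ y) powr (1 + \<epsilon>) * sum b ?F" by (simp add: sum_distrib_left)
      also have "\<dots> \<le> (1 / 2 ^ y) powr (1 + \<epsilon>) * (K * 2 ^ Suc y)"
        using \<open>sum b ?F \<le> _\<close> by (intro mult_left_mono) auto
      \<comment> \<open>The factor \<open>1 / 2 ^ y\<close> cancels the mass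
        \<open>K * 2 ^ Suc y\<close> down to \<open>2 * K\<close>, and the surplus exponent
        \<open>\<epsilon>\<close> leaves a geometric term.\<close>
      also have "(1 / 2 ^ y) powr (1 + \<epsilon>) = (1 / 2 ^ y) * z ^ y"
        by (simp add: z_def powr_add powr_realpow[symmetric] powr_powr powr_minus_divide[symmetric] mult.commute)
      finally show ?thesis by (simp add: mult_ac)
    qed
    have "(\<Sum>k=N..<M. w k powr (1 + \<epsilon>) * b k)
        = (\<Sum>y\<in>j ` {N..<M}. \<Sum>k\<in>{k \<in> {N..<M}. j k = y}. w k powr (1 + \<epsilon>) * b k)"
      by (intro sum.group[symmetric]) auto
    also have "\<dots> \<le> (\<Sum>y\<in>j ` {N..<M}. 2 * K * z ^ y)" by (intro sum_mono cls)
    also have "\<dots> = 2 * K * (\<Sum>y\<in>j ` {N..<M}. z ^ y)" by (simp add: sum_distrib_left)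
    also have "(\<Sum>y\<in>j ` {N..<M}. z ^ y) \<le> (\<Sum>y. z ^ y)"
      using z by (intro sum_le_suminf summable_geometric) auto
    also have "(\<Sum>y. z ^ y) = 1 / (1 - z)" using z by (intro suminf_geometric) auto
    finally show ?thesis using \<open>K > 0\<close> by simp
  qed
  \<comment> \<open>The added 1 puts this tail strictly above the bound that holds for all
    \<open>M\<close>.\<close>
  moreover obtain M where "(\<Sum>k=N..<M. w k powr (1 + \<epsilon>) * b k) \<ge> 2 * K * (1 / (1 - z)) + 1"
    using not_summable_tail_unbounded[OF _ ns] b by (metis mult_nonneg_nonneg powr_ge_zero)
  ultimately show False by (metis add_le_same_cancel1 not_one_le_zero order_trans)
qed

section \<open>Overlaps of arcs pulled back by integer multiples\<close>

text \<open>Since \<open>s\<close> is coprime to \<open>N\<close>, the points are \<open>N\<close>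
  equally spaced points of the circle in another order. Scaling by \<open>N\<close> turns the count
  into one of integers in an interval of length \<open>2 * N * \<rho>\<close>.\<close>

lemma card_circ_ball_orbit_le:
  assumes "coprime s N" "N > 0"
  shows "real (card {k \<in> {..<N}. y + real s * real k / real N \<in> circ_ball c \<rho>}) \<le> real N * ball_length \<rho> + 1"
    (is "real (card ?K) \<le> _")
proof -
  consider "\<rho> \<le> 0" | "0 < \<rho>" "\<rho> \<le> 1/2" | "\<rho> > 1/2" by linarith
  then show ?thesis
  proof cases
    case 1
    then have "?K = {}" by (auto simp: circ_ball_def not_less)
    then show ?thesis using \<open>N > 0\<close> by (simp only: card.empty) (simp add: ball_length_def)
  next
    case 3
    have "card ?K \<le> card {..<N}" by (intro card_mono) auto
    with 3 show ?thesis by (simp add: ball_length_def)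
  next
    case 2
    define R u where "R = real N * \<rho>" and "u = real N * (c - y)"
    have "\<forall>k\<in>?K. \<exists>l::int. \<bar>y + real s * real k / real N - c - of_int l\<bar> < \<rho>"
      by (simp add: circ_ball_def)
    from bchoice[OF this] obtain z :: "nat \<Rightarrow> int" where
      z: "\<And>k. k \<in> ?K \<Longrightarrow> \<bar>y + real s * real k / real N - c - of_int (z k)\<bar> < \<rho>" by blast
    \<comment> \<open>\<open>w k\<close> is congruent to \<open>s * k\<close> modulo
      \<open>N\<close>, so it determines \<open>k < N\<close>. The multiple \<open>z k\<close> of
      the period brings it within \<open>R\<close> of \<open>u\<close>.\<close>
    define w where "w k = int (s * k) - int N * z k" for k
    have inj: "inj_on w ?K"
    proof (rule inj_onI)
      fix k l assume kl: "k \<in> ?K" "l \<in> ?K" "w k = w l"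
      then have "int (s * k) - int (s * l) = int N * (z k - z l)" by (simp add: w_def algebra_simps)
      then have "[int (s * k) = int (s * l)] (mod int N)" by (simp add: cong_iff_dvd_diff)
      then have "[s * k = s * l] (mod N)" by (simp only: cong_int_iff)
      then have "[k = l] (mod N)" using assms by (simp add: cong_mult_lcancel_nat)
      with kl show "k = l" by (auto simp: cong_def)
    qed
    have "w ` ?K \<subseteq> {v. \<bar>of_int v - u\<bar> < R}"
    proof (rule image_subsetI)
      fix k assume "k \<in> ?K"
      from z[OF this] have "real N * \<bar>y + real s * real k / real N - c - of_int (z k)\<bar> < R"
        using \<open>N > 0\<close> by (simp add: R_def)
      also have "real N * \<bar>y + real s * real k / real N - c - of_int (z k)\<bar>
          = \<bar>real N * (y + real s * real k / real N - c - of_int (z k))\<bar>" by (simp add: abs_mult)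
      also have "real N * (y + real s * real k / real N - c - of_int (z k)) = of_int (w k) - u"
        using \<open>N > 0\<close> by (simp add: w_def u_def field_simps)
      finally show "w k \<in> {v. \<bar>of_int v - u\<bar> < R}" by simp
    qed
    moreover have "R \<ge> 0" using 2 by (simp add: R_def)
    ultimately have "real (card (w ` ?K)) \<le> 2 * R + 1"
      using card_ints_in_interval_le[of R u]
      by (meson card_mono of_nat_le_iff order_trans)
    with inj 2 show ?thesis by (simp add: card_image R_def ball_length_def)
  qed
qed

definition scaled_ball :: "nat \<Rightarrow> real \<Rightarrow> real \<Rightarrow> real set" where
  "scaled_ball q c r = {x \<in> {0..<1}. real q * x \<in> circ_ball c r}"

lemma scaled_ball_borel [measurable]: "scaled_ball q c r \<in> sets borel"
  unfolding scaled_ball_def by measurable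

lemma indicator_circ_ball_shift_int [simp]:
  "indicator (circ_ball c r) (x + of_int k) = indicator (circ_ball c r) x"
  "indicator (circ_ball c r) (x + of_nat l) = indicator (circ_ball c r) x"
  "indicator (circ_ball c r) (x + 1) = indicator (circ_ball c r) x"
  using circ_ball_shift_int[of x k c r] circ_ball_shift_int[of x "int l" c r]
    circ_ball_shift_int[of x 1 c r]
  by (simp_all add: indicator_def)

lemma emeasure_scaled_ball:
  assumes "q > 0"
  shows "emeasure lborel (scaled_ball q c r) = ennreal (ball_length r)"
proof -
  have "emeasure lborel (scaled_ball q c r) = (\<integral>\<^sup>+x. indicator (scaled_ball q c r) x \<partial>lborel)" by simp
  also have "\<dots> = (\<integral>\<^sup>+x\<in>{0..<1}. indicator (circ_ball c r) (real q * x) \<partial>lborel)"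
    by (intro nn_integral_cong) (auto simp: scaled_ball_def indicator_def)
  also have "\<dots> = ennreal (ball_length r)"
    using assms by (subst periodic_nn_integral_scale) (auto simp: circ_ball_length)
  finally show ?thesis .
qed

lemma ball_length_bounds [simp]: "0 \<le> ball_length r" "ball_length r \<le> 1"
  by (auto simp: ball_length_def)

lemma emeasure_scaled_ball_Int_le:
  fixes q r :: nat and c c' \<rho> \<rho>' :: real
  assumes "q > 0" "r > 0"
  defines "N \<equiv> q div gcd q r"
  shows "emeasure lborel (scaled_ball q c \<rho> \<inter> scaled_ball r c' \<rho>')
    \<le> ennreal (ball_length \<rho> * ball_length \<rho>' + ball_length \<rho> / real N)"
proof -
  \<comment> \<open>The shifts \<open>x \<mapsto> x + k/q\<close>, \<open>k < N\<close>, preserve the first condition and move the second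
    one along \<open>N\<close> equidistributed points, so that averaging over them decouples the two.\<close>
  define s where "s = r div gcd q r"
  have N: "N > 0" using assms by (simp add: N_def div_greater_zero_iff gcd_le1_nat)
  have cop: "coprime s N" unfolding s_def N_def
    using assms by (simp add: div_gcd_coprime coprime_commute)
  have qr: "real r / real q = real s / real N"
  proof -
    have "real q = real (gcd q r) * real N" "real r = real (gcd q r) * real s"
      unfolding N_def s_def of_nat_mult[symmetric] by simp_all
    then have "real r / real q = (real (gcd q r) * real s) / (real (gcd q r) * real N)" by (simp only:)
    also have "\<dots> = real s / real N" using assms by (intro mult_divide_mult_cancel_left) simp
    finally show ?thesis .
  qed
  define f g where "f x = (indicator (circ_ball c \<rho>) (real q * x) :: ennreal)"
    and "g x = (indicator (circ_ball c' \<rho>') (real r * x) :: ennreal)" for x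
  have [measurable]: "f \<in> borel_measurable borel" "g \<in> borel_measurable borel"
    unfolding f_def g_def by measurable
  have f_per: "f (x + real k / real q) = f x" for x k
    using \<open>q > 0\<close> by (simp add: f_def distrib_left)
  have per: "f (x + 1) * g (x + 1) = f x * g x" for x
    by (simp add: f_def g_def distrib_left)
  define I where "I = (\<integral>\<^sup>+x\<in>{0..<1}. f x * g x \<partial>lborel)"
  have shift: "I = (\<integral>\<^sup>+x\<in>{0..<1}. f x * g (x + real k / real q) \<partial>lborel)" for k :: nat
    unfolding I_def
    using periodic_nn_integral_shift[of "\<lambda>x. f x * g x" "real k / real q"] per by (simp add: f_per)
  have count: "(\<Sum>k<N. g (x + real k / real q)) \<le> ennreal (real N * ball_length \<rho>' + 1)" for x
  proof -
    have "(\<Sum>k<N. g (x + real k / real q))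
        = (\<Sum>k<N. indicator (circ_ball c' \<rho>') (real r * x + real s * real k / real N))"
    proof (intro sum.cong refl)
      fix k
      have "real r * (x + real k / real q) = real r * x + (real r / real q) * real k"
        by (simp add: algebra_simps)
      also have "\<dots> = real r * x + real s * real k / real N" by (simp add: qr)
      finally show "g (x + real k / real q) = indicator (circ_ball c' \<rho>') (real r * x + real s * real k / real N)"
        by (simp add: g_def)
    qed
    also have "\<dots> = of_nat (card {k \<in> {..<N}. real r * x + real s * real k / real N \<in> circ_ball c' \<rho>'})"
      by (simp add: indicator_def sum.If_cases Int_def)
    also have "\<dots> \<le> ennreal (real N * ball_length \<rho>' + 1)"
      unfolding ennreal_of_nat_eq_real_of_nat
      by (intro ennreal_leI card_circ_ball_orbit_le cop N)
    finally show ?thesis .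
  qed
  have "of_nat N * I = (\<Sum>k<N. \<integral>\<^sup>+x\<in>{0..<1}. f x * g (x + real k / real q) \<partial>lborel)"
    using shift by simp
  also have "\<dots> = (\<integral>\<^sup>+x. (\<Sum>k<N. f x * g (x + real k / real q) * indicator {0..<1} x) \<partial>lborel)"
    by (rule nn_integral_sum[symmetric]) measurable
  also have "\<dots> = (\<integral>\<^sup>+x. (f x * indicator {0..<1} x) * (\<Sum>k<N. g (x + real k / real q)) \<partial>lborel)"
    by (intro nn_integral_cong) (simp add: sum_distrib_left mult_ac)
  also have "\<dots> \<le> (\<integral>\<^sup>+x. (f x * indicator {0..<1} x) * ennreal (real N * ball_length \<rho>' + 1) \<partial>lborel)"
    by (intro nn_integral_mono mult_left_mono count) auto
  also have "\<dots> = (\<integral>\<^sup>+x\<in>{0..<1}. f x \<partial>lborel) * ennreal (real N * ball_length \<rho>' + 1)"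
    by (rule nn_integral_multc) measurable
  also have "(\<integral>\<^sup>+x\<in>{0..<1}. f x \<partial>lborel) = ennreal (ball_length \<rho>)"
    unfolding f_def using assms by (subst periodic_nn_integral_scale) (auto simp: circ_ball_length)
  also have "\<dots> * ennreal (real N * ball_length \<rho>' + 1)
      = of_nat N * ennreal (ball_length \<rho> * ball_length \<rho>' + ball_length \<rho> / real N)"
  proof -
    have "ball_length \<rho> * (real N * ball_length \<rho>' + 1)
        = real N * (ball_length \<rho> * ball_length \<rho>' + ball_length \<rho> / real N)"
      using N by (simp add: field_simps)
    then show ?thesis
      unfolding ennreal_of_nat_eq_real_of_nat by (subst (1 2) ennreal_mult[symmetric]) auto
  qed
  finally have "I \<le> ennreal (ball_length \<rho> * ball_length \<rho>' + ball_length \<rho> / real N)"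
    using N by (subst (asm) ennreal_mult_le_mult_iff) auto
  moreover have "emeasure lborel (scaled_ball q c \<rho> \<inter> scaled_ball r c' \<rho>')
      = (\<integral>\<^sup>+x. indicator (scaled_ball q c \<rho> \<inter> scaled_ball r c' \<rho>') x \<partial>lborel)"
    by simp
  moreover have "\<dots> = I" unfolding I_def
    by (intro nn_integral_cong) (auto simp: scaled_ball_def indicator_def f_def g_def)
  ultimately show ?thesis by simp
qed

text \<open>The averaging bound for two pulled-back arcs is not symmetric: shifts by multiples of
  \<open>1/q\<close> give the first entry, shifts by multiples of \<open>1/r\<close> the second.
  Both are valid, hence the minimum.\<close>

definition overlap_err :: "(nat \<Rightarrow> real) \<Rightarrow> nat \<Rightarrow> nat \<Rightarrow> real" where
  "overlap_err a q r = min (a q / real (q div gcd q r)) (a r / real (r div gcd q r))"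

lemma measure_scaled_ball_Int_le:
  fixes rad :: "nat \<Rightarrow> real"
  assumes "q > 0" "r > 0"
  defines "a \<equiv> \<lambda>q. ball_length (rad q)"
  shows "measure lborel (scaled_ball q c (rad q) \<inter> scaled_ball r c' (rad r)) \<le> a q * a r + overlap_err a q r"
proof -
  have "measure lborel (scaled_ball q c (rad q) \<inter> scaled_ball r c' (rad r)) \<le> a q * a r + a q / real (q div gcd q r)"
    using emeasure_scaled_ball_Int_le[of q r c "rad q" c' "rad r"] assms
    by (auto simp: measure_def a_def intro!: enn2real_leI)
  moreover have "measure lborel (scaled_ball q c (rad q) \<inter> scaled_ball r c' (rad r)) \<le> a q * a r + a r / real (r div gcd q r)"
    using emeasure_scaled_ball_Int_le[of r q c' "rad r" c "rad q"] assms
    by (auto simp: measure_def a_def Int_commute gcd.commute mult.commute intro!: enn2real_leI)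
  ultimately show ?thesis by (simp add: overlap_err_def min_def)
qed

text \<open>With \<open>m\<close> the larger of the two reduced denominators, the error is at most
  \<open>a q / m\<close> or \<open>a r / m\<close>, so its square is at most the sum of both
  squares. The two resulting double sums agree by symmetry. It is the square of \<open>m\<close>
  that makes the sum over \<open>r\<close> bounded, by
  \<open>sum_inverse_max_gcd_le\<close>.\<close>

lemma sum_overlap_err_square_le:
  fixes a :: "nat \<Rightarrow> real"
  assumes "finite F" "0 \<notin> F" and a: "\<And>q. a q \<ge> 0"
    and C: "\<And>q. q \<in> F \<Longrightarrow> real q / real (totient q) \<le> C"
  shows "(\<Sum>q\<in>F. \<Sum>r\<in>F. (overlap_err a q r)\<^sup>2) \<le> 4 * C * (\<Sum>q\<in>F. (a q)\<^sup>2)"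
proof -
  let ?m = "\<lambda>q r. real (max (q div gcd q r) (r div gcd q r))"
  have sym: "?m q r = ?m r q" for q r by (simp add: gcd.commute max.commute)
  have e: "(overlap_err a q r)\<^sup>2 \<le> (a q)\<^sup>2 * (1 / (?m q r)\<^sup>2) + (a r)\<^sup>2 * (1 / (?m q r)\<^sup>2)" for q r
  proof -
    have e0: "overlap_err a q r \<ge> 0" using a by (simp add: overlap_err_def)
    have "overlap_err a q r \<le> a q / ?m q r \<or> overlap_err a q r \<le> a r / ?m q r"
      by (auto simp: overlap_err_def max_def)
    then have "(overlap_err a q r)\<^sup>2 \<le> (a q / ?m q r)\<^sup>2 \<or> (overlap_err a q r)\<^sup>2 \<le> (a r / ?m q r)\<^sup>2"
      using e0 by (meson power_mono)
    then show ?thesis by (auto simp: power_divide add_increasing add_increasing2)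
  qed
  have half: "(\<Sum>q\<in>F. \<Sum>r\<in>F. (a q)\<^sup>2 * (1 / (?m q r)\<^sup>2)) \<le> 2 * C * (\<Sum>q\<in>F. (a q)\<^sup>2)"
  proof -
    have "(\<Sum>q\<in>F. \<Sum>r\<in>F. (a q)\<^sup>2 * (1 / (?m q r)\<^sup>2)) = (\<Sum>q\<in>F. (a q)\<^sup>2 * (\<Sum>r\<in>F. 1 / (?m q r)\<^sup>2))"
      by (simp only: sum_distrib_left)
    also have "\<dots> \<le> (\<Sum>q\<in>F. (a q)\<^sup>2 * (2 * C))"
    proof (intro sum_mono mult_left_mono)
      fix q assume q: "q \<in> F"
      with assms have "q > 0" by (metis gr0I)
      with sum_inverse_max_gcd_le[of F q] assms have
        "(\<Sum>r\<in>F. 1 / (?m q r)\<^sup>2) \<le> 2 * (real q / real (totient q))" by simp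
      with C[OF q] show "(\<Sum>r\<in>F. 1 / (?m q r)\<^sup>2) \<le> 2 * C" by linarith
    qed simp
    finally show ?thesis by (simp add: sum_distrib_left mult.commute)
  qed
  have "(\<Sum>q\<in>F. \<Sum>r\<in>F. (overlap_err a q r)\<^sup>2)
      \<le> (\<Sum>q\<in>F. \<Sum>r\<in>F. (a q)\<^sup>2 * (1 / (?m q r)\<^sup>2) + (a r)\<^sup>2 * (1 / (?m q r)\<^sup>2))"
    by (intro sum_mono e)
  also have "\<dots> = (\<Sum>q\<in>F. \<Sum>r\<in>F. (a q)\<^sup>2 * (1 / (?m q r)\<^sup>2)) + (\<Sum>q\<in>F. \<Sum>r\<in>F. (a r)\<^sup>2 * (1 / (?m q r)\<^sup>2))"
    by (simp only: sum.distrib)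
  also have "(\<Sum>q\<in>F. \<Sum>r\<in>F. (a r)\<^sup>2 * (1 / (?m q r)\<^sup>2)) = (\<Sum>q\<in>F. \<Sum>r\<in>F. (a q)\<^sup>2 * (1 / (?m q r)\<^sup>2))"
    by (subst sum.swap) (simp only: sym)
  finally show ?thesis using half by simp
qed

section \<open>Independence of two linear forms on the torus\<close>

lemma periodic_nn_integral_independent:
  fixes f g :: "real \<Rightarrow> ennreal" and Q R k l :: nat
  assumes f[measurable]: "f \<in> borel_measurable borel" and f_per: "\<And>x. f (x + 1) = f x"
    and g[measurable]: "g \<in> borel_measurable borel" and g_per: "\<And>x. g (x + 1) = g x"
    and "Q > 0" and det: "R * k < Q * l"
  shows "(\<integral>\<^sup>+y\<in>{0..<1}. (\<integral>\<^sup>+x\<in>{0..<1}. f (real Q * x + real k * y) * g (real R * x + real l * y) \<partial>lborel) \<partial>lborel)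
    = (\<integral>\<^sup>+x\<in>{0..<1}. f x \<partial>lborel) * (\<integral>\<^sup>+x\<in>{0..<1}. g x \<partial>lborel)"
proof -
  \<comment> \<open>Scaling \<open>y\<close> by \<open>Q\<close> makes the shear \<open>x \<mapsto> x - k z\<close> integral; it removes \<open>y\<close> from \<open>f\<close> and leaves
    the determinant \<open>D\<close> as its coefficient in \<open>g\<close>.\<close>
  define D where "D = Q * l - R * k"
  have D: "D > 0" "real D = real Q * real l - real R * real k"
    using det by (auto simp: D_def of_nat_diff)
  have fp: "f (x + real n) = f x" "g (x + real n) = g x" for x and n :: nat
    using periodic_int[of f x "int n", OF f_per] periodic_int[of g x "int n", OF g_per] by simp_all
  define H where "H y = (\<integral>\<^sup>+x\<in>{0..<1}. f (real Q * x + real k * y) * g (real R * x + real l * y) \<partial>lborel)" for y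
  have [measurable]: "H \<in> borel_measurable borel"
    unfolding H_def by (intro lborel.borel_measurable_nn_integral) measurable
  have H_per: "H (y + 1) = H y" for y
    unfolding H_def by (simp add: distrib_left fp add.assoc[symmetric])
  have HQ: "H (real Q * z) = (\<integral>\<^sup>+x\<in>{0..<1}. f (real Q * x) * g (real R * x + real D * z) \<partial>lborel)" for z
  proof -
    let ?F = "\<lambda>x. f (real Q * x + real k * (real Q * z)) * g (real R * x + real l * (real Q * z))"
    have per: "?F (x + 1) = ?F x" for x
      using fp[of "real Q * x + real k * (real Q * z)" Q] fp[of "real R * x + real l * (real Q * z)" R]
      by (simp add: algebra_simps)
    have "H (real Q * z) = (\<integral>\<^sup>+x\<in>{0..<1}. ?F (x + (- real k * z)) \<partial>lborel)"
      unfolding H_def by (rule periodic_nn_integral_shift[symmetric]) (use per in auto)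
    also have "\<dots> = (\<integral>\<^sup>+x\<in>{0..<1}. f (real Q * x) * g (real R * x + real D * z) \<partial>lborel)"
      by (simp add: D algebra_simps)
    finally show ?thesis .
  qed
  have "(\<integral>\<^sup>+y\<in>{0..<1}. H y \<partial>lborel) = (\<integral>\<^sup>+z\<in>{0..<1}. H (real Q * z) \<partial>lborel)"
    by (rule periodic_nn_integral_scale[symmetric]) (use H_per \<open>Q > 0\<close> in auto)
  also have "\<dots> = (\<integral>\<^sup>+z. (\<integral>\<^sup>+x. f (real Q * x) * g (real R * x + real D * z) * indicator {0..<1} x * indicator {0..<1} z \<partial>lborel) \<partial>lborel)"
    unfolding HQ by (intro nn_integral_cong nn_integral_multc[symmetric]) measurable
  \<comment> \<open>With \<open>z\<close> innermost, \<open>g\<close> is averaged over full periods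
    whatever \<open>x\<close> is, so its integral becomes a constant factor.\<close>
  also have "\<dots> = (\<integral>\<^sup>+x. (\<integral>\<^sup>+z. f (real Q * x) * g (real R * x + real D * z) * indicator {0..<1} x * indicator {0..<1} z \<partial>lborel) \<partial>lborel)"
    by (rule lborel_pair.Fubini') measurable
  also have "\<dots> = (\<integral>\<^sup>+x. f (real Q * x) * indicator {0..<1} x * (\<integral>\<^sup>+z\<in>{0..<1}. g (real R * x + real D * z) \<partial>lborel) \<partial>lborel)"
    by (subst nn_integral_cmult[symmetric]) (auto simp: mult_ac)
  also have "\<dots> = (\<integral>\<^sup>+x. f (real Q * x) * indicator {0..<1} x * (\<integral>\<^sup>+z\<in>{0..<1}. g z \<partial>lborel) \<partial>lborel)"
  proof (rule nn_integral_cong)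
    fix x :: real
    have "(\<integral>\<^sup>+z\<in>{0..<1}. g (real R * x + real D * z) \<partial>lborel) = (\<integral>\<^sup>+z\<in>{0..<1}. g (real R * x + z) \<partial>lborel)"
      using D g_per by (intro periodic_nn_integral_scale[where f = "\<lambda>z. g (real R * x + z)"]) (auto simp: add.assoc[symmetric])
    also have "\<dots> = (\<integral>\<^sup>+z\<in>{0..<1}. g z \<partial>lborel)"
      using periodic_nn_integral_shift[of g "real R * x"] g_per by (simp add: add.commute)
    finally show "f (real Q * x) * indicator {0..<1} x * (\<integral>\<^sup>+z\<in>{0..<1}. g (real R * x + real D * z) \<partial>lborel)
      = f (real Q * x) * indicator {0..<1} x * (\<integral>\<^sup>+z\<in>{0..<1}. g z \<partial>lborel)" by simp
  qed
  also have "\<dots> = (\<integral>\<^sup>+x\<in>{0..<1}. f (real Q * x) \<partial>lborel) * (\<integral>\<^sup>+z\<in>{0..<1}. g z \<partial>lborel)"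
    by (rule nn_integral_multc) measurable
  also have "(\<integral>\<^sup>+x\<in>{0..<1}. f (real Q * x) \<partial>lborel) = (\<integral>\<^sup>+x\<in>{0..<1}. f x \<partial>lborel)"
    using f_per \<open>Q > 0\<close> by (intro periodic_nn_integral_scale) auto
  finally show ?thesis unfolding H_def .
qed

lemma nn_integral_PiM_two:
  fixes h :: "real \<Rightarrow> real \<Rightarrow> ennreal"
  assumes "i \<noteq> j" and h[measurable]: "(\<lambda>(u, v). h u v) \<in> borel_measurable (lborel \<Otimes>\<^sub>M lborel)"
  shows "(\<integral>\<^sup>+x. h (x i) (x j) \<partial>Pi\<^sub>M {i, j} (\<lambda>_. lborel)) = (\<integral>\<^sup>+v. (\<integral>\<^sup>+u. h u v \<partial>lborel) \<partial>lborel)"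
proof -
  interpret product_sigma_finite "\<lambda>_. lborel :: real measure" ..
  have "(\<lambda>x. h (x i) (x j)) = (\<lambda>x. (\<lambda>(u, v). h u v) (x i, x j))" by simp
  also have "\<dots> \<in> borel_measurable (Pi\<^sub>M (insert i {j}) (\<lambda>_. lborel))"
    by (rule measurable_compose[OF _ h]) measurable
  finally have "(\<integral>\<^sup>+x. h (x i) (x j) \<partial>Pi\<^sub>M {i, j} (\<lambda>_. lborel))
      = (\<integral>\<^sup>+x. (\<integral>\<^sup>+u. h u (x j) \<partial>lborel) \<partial>Pi\<^sub>M {j} (\<lambda>_. lborel))"
    using assms(1) by (subst product_nn_integral_insert) auto
  also have "\<dots> = (\<integral>\<^sup>+v. (\<integral>\<^sup>+u. h u v \<partial>lborel) \<partial>lborel)"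
    using h by (intro product_nn_integral_singleton) measurable
  finally show ?thesis .
qed

section \<open>Torus balls as products of arcs, and the approximation set\<close>

text \<open>In the max norm the integer translates can be chosen in each coordinate separately. This
  makes the ball a product of arcs and its measure a power of \<open>ball_length r\<close>.\<close>

lemma in_torus_ball_iff: "in_torus_ball m c r y \<longleftrightarrow> (\<forall>j<m. y j \<in> circ_ball (c j) r)"
proof
  assume "\<forall>j<m. y j \<in> circ_ball (c j) r"
  then have "\<forall>j\<in>{..<m}. \<exists>k::int. \<bar>y j - c j - of_int k\<bar> < r" by (simp add: circ_ball_def)
  from bchoice[OF this] show "in_torus_ball m c r y" by (auto simp: in_torus_ball_def)
qed (auto simp: in_torus_ball_def circ_ball_def)

lemma emeasure_PiE_lborel:
  assumes "finite I" "\<And>i. i \<in> I \<Longrightarrow> A i \<in> sets borel"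
  shows "emeasure (Pi\<^sub>M I (\<lambda>_. lborel)) (Pi\<^sub>E I A) = (\<Prod>i\<in>I. emeasure lborel (A i :: real set))"
proof -
  interpret product_sigma_finite "\<lambda>_. lborel :: real measure" ..
  show ?thesis using assms by (intro emeasure_PiM) auto
qed

lemma torus_ball_measure_eq: "torus_ball_measure m c r = ball_length r ^ m"
proof -
  have "{y \<in> {..<m} \<rightarrow>\<^sub>E {0..<1}. in_torus_ball m c r y} = Pi\<^sub>E {..<m} (\<lambda>j. scaled_ball 1 (c j) r)"
    by (rule Set.set_eqI, simp add: in_torus_ball_iff scaled_ball_def PiE_iff Ball_def, blast)
  moreover have "emeasure (Pi\<^sub>M {..<m} (\<lambda>_. lborel)) (Pi\<^sub>E {..<m} (\<lambda>j. scaled_ball 1 (c j) r)) = ennreal (ball_length r) ^ m"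
    by (subst emeasure_PiE_lborel) (simp_all add: emeasure_scaled_ball)
  ultimately show ?thesis
    unfolding torus_ball_measure_def measure_def by (simp add: ennreal_power)
qed

text \<open>\<open>approx_set\<close> counts pairs, and distinct \<open>q\<close> give distinct
  pairs. For each \<open>q\<close> in \<open>V\<close> the integers \<open>k j\<close> witnessing
  membership in the arcs supply \<open>p = - k\<close>.\<close>

lemma approx_setI:
  assumes x: "x \<in> ({..<n} \<times> {..<m}) \<rightarrow>\<^sub>E {0..<1}" and "infinite V"
    and V: "\<And>q. q \<in> V \<Longrightarrow> q \<in> {..<n} \<rightarrow>\<^sub>E UNIV \<and> (\<exists>i<n. q i \<noteq> 0) \<and>
      (\<forall>j<m. (\<Sum>i<n. of_int (q i) * x (i, j)) \<in> circ_ball (cen (sup_norm_int n q) j) (rad (sup_norm_int n q)))"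
  shows "x \<in> approx_set n m cen rad"
proof -
  let ?S = "{(p, q). p \<in> {..<m} \<rightarrow>\<^sub>E (UNIV :: int set) \<and> q \<in> {..<n} \<rightarrow>\<^sub>E (UNIV :: int set) \<and>
                          (\<exists>i<n. q i \<noteq> 0) \<and>
                          (\<forall>j<m. \<bar>vec_mat n m q x j + of_int (p j) - cen (sup_norm_int n q) j\<bar>
                                    < rad (sup_norm_int n q))}"
  have "V \<subseteq> snd ` ?S"
  proof
    fix q assume q: "q \<in> V"
    define c r where "c = cen (sup_norm_int n q)" and "r = rad (sup_norm_int n q)"
    have "\<forall>j\<in>{..<m}. \<exists>k::int. \<bar>(\<Sum>i<n. of_int (q i) * x (i, j)) - c j - of_int k\<bar> < r"
      using V[OF q] by (simp add: circ_ball_def c_def r_def)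
    from bchoice[OF this] obtain k :: "nat \<Rightarrow> int" where
      k: "\<And>j. j < m \<Longrightarrow> \<bar>(\<Sum>i<n. of_int (q i) * x (i, j)) - c j - of_int (k j)\<bar> < r" by auto
    have "(restrict (\<lambda>j. - k j) {..<m}, q) \<in> ?S"
      using V[OF q] k by (auto simp: vec_mat_def c_def[symmetric] r_def[symmetric] algebra_simps)
    then show "q \<in> snd ` ?S" by (rule rev_image_eqI) simp
  qed
  then have "infinite ?S" using \<open>infinite V\<close> by (meson finite_imageI finite_subset)
  moreover have "x \<in> ({..<n} \<times> {..<m}) \<rightarrow>\<^sub>E {0..1}"
    by (rule subsetD[OF PiE_mono x]) auto
  ultimately show ?thesis unfolding approx_set_def by (intro CollectI conjI)
qed

text \<open>There are countably many pairs, hence countably many finite sets \<open>G\<close> of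
  pairs. Infinitely many solutions means a solution outside every such \<open>G\<close>, which is a
  countable intersection of countable unions.\<close>

lemma sets_approx_set: "approx_set n m cen rad \<in> sets (Pi\<^sub>M ({..<n} \<times> {..<m}) (\<lambda>_. lborel))"
proof -
  let ?M = "Pi\<^sub>M ({..<n} \<times> {..<m}) (\<lambda>_. lborel) :: (nat \<times> nat \<Rightarrow> real) measure"
  define C where "C = {(p, q). p \<in> {..<m} \<rightarrow>\<^sub>E (UNIV :: int set) \<and> q \<in> {..<n} \<rightarrow>\<^sub>E (UNIV :: int set) \<and>
                          (\<exists>i<n. q i \<noteq> 0)}"
  define P where "P = (\<lambda>(p, q) x. \<forall>j<m. \<bar>vec_mat n m q x j + of_int (p j :: int) - cen (sup_norm_int n q) j\<bar>
                                    < rad (sup_norm_int n q))"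
  have "countable (({..<m} \<rightarrow>\<^sub>E (UNIV :: int set)) \<times> ({..<n} \<rightarrow>\<^sub>E (UNIV :: int set)))"
    by (intro countable_SIGMA countable_PiE) auto
  then have C: "countable C" by (rule countable_subset[rotated]) (auto simp: C_def)
  have P: "{x \<in> space ?M. P c x} \<in> sets ?M" for c
  proof -
    obtain p q where c: "c = (p, q)" by (cases c)
    have "{x \<in> space ?M. P c x} = {x \<in> space ?M. \<forall>j\<in>{..<m}.
        \<bar>(\<Sum>i<n. of_int (q i) * x (i, j)) + of_int (p j :: int) - cen (sup_norm_int n q) j\<bar> < rad (sup_norm_int n q)}"
      by (auto simp: P_def c vec_mat_def)
    also have "\<dots> \<in> sets ?M"
    proof (rule sets.sets_Collect_finite_All)
      fix j assume "j \<in> {..<m}"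
      then have [measurable]: "(\<lambda>x. x (i, j)) \<in> borel_measurable ?M" if "i < n" for i
        using that measurable_component_singleton[of "(i, j)" "{..<n} \<times> {..<m}" "\<lambda>_. lborel"] by simp
      have [measurable]: "(\<lambda>x. \<Sum>i<n. of_int (q i) * x (i, j)) \<in> borel_measurable ?M"
        by (intro borel_measurable_sum borel_measurable_times) auto
      show "{x \<in> space ?M. \<bar>(\<Sum>i<n. of_int (q i) * x (i, j)) + of_int (p j :: int) - cen (sup_norm_int n q) j\<bar>
          < rad (sup_norm_int n q)} \<in> sets ?M" by measurable
    qed auto
    finally show ?thesis .
  qed
  have cube: "({..<n} \<times> {..<m}) \<rightarrow>\<^sub>E {0..1::real} \<in> sets ?M"
    by (intro sets_PiM_I_finite) auto
  define \<G> where "\<G> = {G. finite G \<and> G \<subseteq> C}"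
  have "countable \<G>" unfolding \<G>_def using countable_Collect_finite_subset[OF C] by (simp add: conj_commute)
  have inf: "infinite {c \<in> C. P c x} \<longleftrightarrow> (\<forall>G\<in>\<G>. \<exists>c\<in>C - G. P c x)" for x
  proof
    assume inf: "infinite {c \<in> C. P c x}"
    show "\<forall>G\<in>\<G>. \<exists>c\<in>C - G. P c x"
    proof (rule ballI, rule ccontr)
      fix G assume "G \<in> \<G>" "\<not> (\<exists>c\<in>C - G. P c x)"
      then have "{c \<in> C. P c x} \<subseteq> G" "finite G" by (auto simp: \<G>_def)
      with inf show False by (meson finite_subset)
    qed
  next
    assume "\<forall>G\<in>\<G>. \<exists>c\<in>C - G. P c x"
    then show "infinite {c \<in> C. P c x}" by (auto simp: \<G>_def)
  qed
  have pairs: "{(p, q). p \<in> {..<m} \<rightarrow>\<^sub>E (UNIV :: int set) \<and> q \<in> {..<n} \<rightarrow>\<^sub>E (UNIV :: int set) \<and>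
                          (\<exists>i<n. q i \<noteq> 0) \<and>
                          (\<forall>j<m. \<bar>vec_mat n m q x j + of_int (p j) - cen (sup_norm_int n q) j\<bar>
                                    < rad (sup_norm_int n q))} = {c \<in> C. P c x}" for x
    by (auto simp: C_def P_def)
  have mem: "x \<in> approx_set n m cen rad
      \<longleftrightarrow> x \<in> ({..<n} \<times> {..<m}) \<rightarrow>\<^sub>E {0..1} \<and> (\<forall>G\<in>\<G>. \<exists>c\<in>C - G. P c x)" for x
    by (simp only: approx_set_def mem_Collect_eq pairs inf)
  have "approx_set n m cen rad
      = {x \<in> space ?M. \<forall>G\<in>\<G>. \<exists>c\<in>C - G. P c x} \<inter> (({..<n} \<times> {..<m}) \<rightarrow>\<^sub>E {0..1})"
  proof -
    have *: "X = {x \<in> Z. Q x} \<inter> Y" if "\<And>x. x \<in> X \<longleftrightarrow> x \<in> Y \<and> Q x" "Y \<subseteq> Z"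
      for X Y Z :: "(nat \<times> nat \<Rightarrow> real) set" and Q using that by blast
    show ?thesis by (rule *[OF mem sets.sets_into_space[OF cube]])
  qed
  also have "\<dots> \<in> sets ?M"
  proof (rule sets.Int[OF _ cube])
    have "{x \<in> space ?M. \<exists>c\<in>C - G. P c x} \<in> sets ?M" for G
      using C by (intro sets.sets_Collect_countable_Ex' P countable_Diff)
    then show "{x \<in> space ?M. \<forall>G\<in>\<G>. \<exists>c\<in>C - G. P c x} \<in> sets ?M"
      using \<open>countable \<G>\<close> by (intro sets.sets_Collect_countable_All')
  qed
  finally show ?thesis .
qed

text \<open>The closed and the half-open unit cube both have measure 1; the first bounds the set
  from above, the second from below.\<close>

lemma emeasure_approx_set_eq_1I:
  assumes "AE x in Pi\<^sub>M ({..<n} \<times> {..<m}) (\<lambda>_. lborel).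
    x \<in> ({..<n} \<times> {..<m}) \<rightarrow>\<^sub>E {0..<1} \<longrightarrow> x \<in> approx_set n m cen rad"
  shows "emeasure (Pi\<^sub>M ({..<n} \<times> {..<m}) (\<lambda>_. lborel)) (approx_set n m cen rad) = 1"
proof (rule antisym)
  let ?M = "Pi\<^sub>M ({..<n} \<times> {..<m}) (\<lambda>_. lborel) :: (nat \<times> nat \<Rightarrow> real) measure"
  have "emeasure ?M (approx_set n m cen rad) \<le> emeasure ?M (({..<n} \<times> {..<m}) \<rightarrow>\<^sub>E {0..1})"
    by (intro emeasure_mono sets_PiM_I_finite) (auto simp: approx_set_def)
  also have "\<dots> = 1" by (simp add: emeasure_PiE_lborel)
  finally show "emeasure ?M (approx_set n m cen rad) \<le> 1" .
  have "1 = emeasure ?M (({..<n} \<times> {..<m}) \<rightarrow>\<^sub>E {0..<1})" by (simp add: emeasure_PiE_lborel)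
  also have "\<dots> \<le> emeasure ?M (approx_set n m cen rad)"
    using assms by (intro emeasure_mono_AE sets_approx_set) auto
  finally show "1 \<le> emeasure ?M (approx_set n m cen rad)" .
qed

lemma half_open_cube:
  assumes "finite I"
  shows "I \<rightarrow>\<^sub>E {0..<1::real} \<in> fmeasurable (Pi\<^sub>M I (\<lambda>_. lborel))"
    and "measure (Pi\<^sub>M I (\<lambda>_. lborel)) (I \<rightarrow>\<^sub>E {0..<1::real}) = 1"
  using assms by (auto simp: fmeasurable_def measure_def emeasure_PiE_lborel intro!: sets_PiM_I_finite)

section \<open>The case \<open>n = 1\<close>, \<open>m = 2\<close>\<close>

text \<open>Young's inequality for the cross term \<open>2 * u * e\<close>, weighted so that the
  coefficient of the main term stays close to 1.\<close>

lemma add_square_le: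
  fixes u e \<eta> :: real
  assumes "\<eta> > 0"
  shows "(u + e)\<^sup>2 \<le> (1 + \<eta>) * u\<^sup>2 + (1 + 1 / \<eta>) * e\<^sup>2"
proof -
  have "0 \<le> (\<eta> * u - e)\<^sup>2 / \<eta>" using assms by simp
  also have "\<dots> = \<eta> * u\<^sup>2 + e\<^sup>2 / \<eta> - 2 * u * e"
    using assms by (simp add: field_simps power2_eq_square)
  finally show ?thesis by (simp add: power2_eq_square algebra_simps)
qed

text \<open>Each \<open>A q\<close> is a product over the two coordinates, so overlaps multiply and
  the one-coordinate error enters squared, as \<open>sum_overlap_err_square_le\<close>
  requires.\<close>

theorem approx_set_1_2_full:
  fixes \<epsilon> :: real and cen :: "nat \<Rightarrow> nat \<Rightarrow> real" and rad :: "nat \<Rightarrow> real"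
  assumes "\<epsilon> > 0"
    and ns: "\<not> summable (\<lambda>k. (real (totient (Suc k)) / real (Suc k)) powr (1 + \<epsilon>) * (ball_length (rad (Suc k)))\<^sup>2)"
  shows "emeasure (Pi\<^sub>M ({..<1} \<times> {..<2}) (\<lambda>_. lborel)) (approx_set 1 2 cen rad) = 1"
proof -
  let ?I = "{..<1} \<times> {..<2} :: (nat \<times> nat) set"
  let ?M = "Pi\<^sub>M ?I (\<lambda>_. lborel) :: (nat \<times> nat \<Rightarrow> real) measure"
  define a where "a q = ball_length (rad q)" for q
  define E where "E q ij = scaled_ball q (cen q (snd ij)) (rad q)" for q and ij :: "nat \<times> nat"
  define A where "A q = Pi\<^sub>E ?I (E q)" for q
  have E_sets: "E q ij \<in> sets borel" for q ij by (simp add: E_def)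
  have prod_I: "(\<Prod>ij\<in>?I. h ij) = h (0, 0) * h (0, 1)" for h :: "nat \<times> nat \<Rightarrow> ennreal"
  proof -
    have "?I = {(0, 0), (0, 1)}" by (auto simp: less_2_cases_iff)
    then show ?thesis by simp
  qed
  have A_sets: "A q \<in> sets ?M" for q
    unfolding A_def by (intro sets_PiM_I_finite) (auto simp: E_def)
  have A_sub: "A q \<subseteq> ?I \<rightarrow>\<^sub>E {0..<1}" for q
    unfolding A_def by (intro PiE_mono) (auto simp: E_def scaled_ball_def)
  have A_fm: "A q \<in> fmeasurable ?M" for q
    by (rule fmeasurableI2[OF half_open_cube(1) A_sub A_sets]) simp
  have a: "0 \<le> a q" for q by (simp add: a_def)
  have A_measure: "measure ?M (A q) = (a q)\<^sup>2" if "q > 0" for q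
    using that unfolding measure_def A_def
    by (subst emeasure_PiE_lborel)
      (auto simp: E_def prod_I emeasure_scaled_ball a_def power2_eq_square ennreal_mult[symmetric] scaled_ball_borel)
  have Int_measure: "measure ?M (A q \<inter> A r) \<le> (a q * a r + overlap_err a q r)\<^sup>2" if "q > 0" "r > 0" for q r
  proof -
    have fin: "emeasure lborel (E q ij \<inter> E r ij) = ennreal (measure lborel (E q ij \<inter> E r ij))" for ij
    proof -
      have "emeasure lborel (E q ij \<inter> E r ij) \<le> emeasure lborel (E q ij)"
        by (intro emeasure_mono) (auto simp: E_sets)
      also have "\<dots> < \<infinity>" using that by (simp add: E_def emeasure_scaled_ball)
      finally show ?thesis by (intro emeasure_eq_ennreal_measure) auto
    qed
    have le: "measure lborel (E q ij \<inter> E r ij) \<le> a q * a r + overlap_err a q r" for ij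
      unfolding E_def a_def by (rule measure_scaled_ball_Int_le[OF that])
    have "measure ?M (A q \<inter> A r) = measure lborel (E q (0, 0) \<inter> E r (0, 0)) * measure lborel (E q (0, 1) \<inter> E r (0, 1))"
      unfolding measure_def[of ?M] A_def PiE_Int
      by (subst emeasure_PiE_lborel)
        (simp_all add: E_sets sets.Int prod_I fin ennreal_mult[symmetric] del: One_nat_def)
    also have "\<dots> \<le> (a q * a r + overlap_err a q r) * (a q * a r + overlap_err a q r)"
      by (rule mult_mono[OF le le order_trans[OF measure_nonneg le] measure_nonneg])
    finally show ?thesis by (simp add: power2_eq_square)
  qed
  have "AE x in ?M. x \<in> ?I \<rightarrow>\<^sub>E {0..<1} \<longrightarrow> infinite {q \<in> {0<..}. x \<in> A q}"
  proof (rule AE_infinitely_often[where lev = id])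
    fix \<delta> :: real and N :: nat
    assume "\<delta> > 0"
    \<comment> \<open>Half of \<open>\<delta>\<close> is spent on the main term in
      \<open>add_square_le\<close>, the other half on the total error.\<close>
    define \<eta> where "\<eta> = \<delta> / 2"
    \<comment> \<open>Chosen so that the error bound \<open>(1 + 1 / \<eta>) * (4 * C * S)\<close>
      equals \<open>\<eta> * (K * C) * S\<close>, which is at most \<open>\<eta> * S\<^sup>2\<close>
      once \<open>S \<ge> K * C\<close>.\<close>
    define K where "K = 4 * (1 + 1 / \<eta>) / \<eta>"
    have \<eta>: "\<eta> > 0" using \<open>\<delta> > 0\<close> by (simp add: \<eta>_def)
    then have K: "K > 0" by (simp add: K_def add_pos_pos)
    define w where "w k = real (totient (Suc k)) / real (Suc k)" for k
    have w: "w k > 0" "w k \<le> 1" for k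
      using totient_le[of "Suc k"] by (auto simp: w_def simp del: of_nat_Suc)
    obtain C F where CF: "C \<ge> 1" "finite F" "F \<subseteq> {N..}" "\<forall>k\<in>F. 1 / w k \<le> C"
        "(\<Sum>k\<in>F. (a (Suc k))\<^sup>2) \<ge> K * C"
      using divergent_weighted_sum_class[of "\<lambda>k. (a (Suc k))\<^sup>2" w \<epsilon> K N] w K \<open>\<epsilon> > 0\<close> ns
      unfolding a_def w_def by auto
    \<comment> \<open>The series is indexed by \<open>k = q - 1\<close>; \<open>G\<close> holds the
      values \<open>q\<close> themselves.\<close>
    define G where "G = Suc ` F"
    have G: "finite G" "0 \<notin> G" using CF by (auto simp: G_def)
    have G_C: "real q / real (totient q) \<le> C" if "q \<in> G" for q
      using that CF(4) by (auto simp: G_def w_def)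
    define S where "S = (\<Sum>q\<in>G. (a q)\<^sup>2)"
    have S: "S \<ge> K * C" using CF(5) by (simp add: S_def G_def sum.reindex)
    have "S > 0" using S K CF(1) by (smt (verit) mult_pos_pos)
    have pos: "q > 0" if "q \<in> G" for q using that by (auto simp: G_def)
    have "(\<Sum>q\<in>G. \<Sum>r\<in>G. measure ?M (A q \<inter> A r))
        \<le> (\<Sum>q\<in>G. \<Sum>r\<in>G. (1 + \<eta>) * ((a q)\<^sup>2 * (a r)\<^sup>2) + (1 + 1 / \<eta>) * (overlap_err a q r)\<^sup>2)"
    proof (intro sum_mono)
      fix q r assume "q \<in> G" "r \<in> G"
      then have "measure ?M (A q \<inter> A r) \<le> (a q * a r + overlap_err a q r)\<^sup>2"
        using pos by (intro Int_measure) auto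
      also have "\<dots> \<le> (1 + \<eta>) * (a q * a r)\<^sup>2 + (1 + 1 / \<eta>) * (overlap_err a q r)\<^sup>2"
        using \<eta> by (rule add_square_le)
      finally show "measure ?M (A q \<inter> A r)
          \<le> (1 + \<eta>) * ((a q)\<^sup>2 * (a r)\<^sup>2) + (1 + 1 / \<eta>) * (overlap_err a q r)\<^sup>2"
        by (simp add: power_mult_distrib)
    qed
    also have "\<dots> = (1 + \<eta>) * S\<^sup>2 + (1 + 1 / \<eta>) * (\<Sum>q\<in>G. \<Sum>r\<in>G. (overlap_err a q r)\<^sup>2)"
      by (simp add: sum.distrib sum_distrib_left[symmetric] S_def power2_eq_square[of "sum _ _"] sum_product)
    also have "\<dots> \<le> (1 + \<eta>) * S\<^sup>2 + (1 + 1 / \<eta>) * (4 * C * S)"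
      using sum_overlap_err_square_le[of G a C] G G_C a \<eta>
      by (intro add_left_mono mult_left_mono) (auto simp: S_def)
    also have "(1 + 1 / \<eta>) * (4 * C * S) = \<eta> * (K * C) * S"
      using \<eta> by (simp add: K_def)
    also have "\<dots> \<le> \<eta> * S * S" using S \<eta> \<open>S > 0\<close> by (intro mult_right_mono mult_left_mono) auto
    also have "(1 + \<eta>) * S\<^sup>2 + \<eta> * S * S = (1 + \<delta>) * S\<^sup>2"
      by (simp add: \<eta>_def power2_eq_square algebra_simps)
    finally have "measure ?M (\<Union>q\<in>G. A q) \<ge> 1 - \<delta>"
      using G A_fm \<open>\<delta> > 0\<close> \<open>S > 0\<close> A_measure pos
      by (intro second_moment_union_ge[where S = S]) (auto simp: S_def)
    then show "\<exists>G. finite G \<and> G \<subseteq> {q \<in> {0<..}. id q \<ge> N} \<and> measure ?M (\<Union>q\<in>G. A q) \<ge> 1 - \<delta>"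
      using G CF(3) by (intro exI[of _ G]) (auto simp: G_def)
  qed (use half_open_cube[of ?I] A_sets A_sub in auto)
  then have "AE x in ?M. x \<in> ?I \<rightarrow>\<^sub>E {0..<1} \<longrightarrow> x \<in> approx_set 1 2 cen rad"
  proof (eventually_elim, intro impI)
    fix x assume x: "x \<in> ?I \<rightarrow>\<^sub>E {0..<1}"
      and "x \<in> ?I \<rightarrow>\<^sub>E {0..<1} \<longrightarrow> infinite {q \<in> {0<..}. x \<in> A q}"
    then have inf: "infinite {q \<in> {0<..}. x \<in> A q}" by blast
    define v where "v q = restrict (\<lambda>_. int q) {..<1::nat}" for q
    have v0: "v q 0 = int q" for q by (simp add: v_def)
    have norm: "sup_norm_int 1 (v q) = q" for q
      by (simp add: sup_norm_int_def v0 lessThan_Suc)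
    have "inj v" by (rule injI) (metis v0 of_nat_eq_iff)
    show "x \<in> approx_set 1 2 cen rad"
    proof (rule approx_setI[OF x, where V = "v ` {q \<in> {0<..}. x \<in> A q}"])
      show "infinite (v ` {q \<in> {0<..}. x \<in> A q})"
        using inf \<open>inj v\<close> by (meson finite_imageD inj_on_subset subset_UNIV)
    next
      fix u assume "u \<in> v ` {q \<in> {0<..}. x \<in> A q}"
      then obtain q where q: "u = v q" "q > 0" "x \<in> A q" by auto
      have "u \<in> {..<1} \<rightarrow>\<^sub>E UNIV" by (simp add: q v_def)
      moreover have "\<exists>i<1. u i \<noteq> 0" using q by (auto simp: v0)
      moreover have "real q * x (0, j) \<in> circ_ball (cen q j) (rad q)" if "j < 2" for j
        using q(3) that by (auto simp: A_def E_def scaled_ball_def PiE_iff)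
      ultimately show "u \<in> {..<1} \<rightarrow>\<^sub>E UNIV \<and> (\<exists>i<1. u i \<noteq> 0) \<and>
        (\<forall>j<2. (\<Sum>i<1. of_int (u i) * x (i, j)) \<in> circ_ball (cen (sup_norm_int 1 u) j) (rad (sup_norm_int 1 u)))"
        unfolding q(1) norm by (simp add: v0 lessThan_Suc)
    qed
  qed
  then show ?thesis by (rule emeasure_approx_set_eq_1I)
qed

section \<open>The case \<open>n = 2\<close>, \<open>m = 1\<close>\<close>

text \<open>The condition \<open>R * k < Q * l\<close> says that the two integer forms have positive
  determinant. The iterated integral of \<open>periodic_nn_integral_independent\<close> is
  transferred to the product measure on an arbitrary pair of indices.\<close>

lemma emeasure_linear_form_Int:
  fixes Q R k l :: nat and c c' \<rho> \<rho>' :: real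
  assumes "i \<noteq> j" "Q > 0" "R * k < Q * l"
  shows "emeasure (Pi\<^sub>M {i, j} (\<lambda>_. lborel))
    {x \<in> {i, j} \<rightarrow>\<^sub>E {0..<1}. real Q * x i + real k * x j \<in> circ_ball c \<rho> \<and>
      real R * x i + real l * x j \<in> circ_ball c' \<rho>'} = ennreal (ball_length \<rho> * ball_length \<rho>')"
    (is "emeasure ?M ?X = _")
proof -
  define f g where "f = (indicator (circ_ball c \<rho>) :: real \<Rightarrow> ennreal)"
    and "g = (indicator (circ_ball c' \<rho>') :: real \<Rightarrow> ennreal)"
  have [measurable]: "f \<in> borel_measurable borel" "g \<in> borel_measurable borel"
    unfolding f_def g_def by measurable
  define h where "h u v = f (real Q * u + real k * v) * g (real R * u + real l * v)
    * indicator {0..<1} u * indicator {0..<1} v" for u v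
  have h_meas: "(\<lambda>(u, v). h u v) \<in> borel_measurable (lborel \<Otimes>\<^sub>M lborel)"
    unfolding h_def by measurable
  have comp: "(\<lambda>x. x i) \<in> borel_measurable ?M" "(\<lambda>x. x j) \<in> borel_measurable ?M"
    using measurable_component_singleton[of i "{i, j}" "\<lambda>_. lborel :: real measure"]
      measurable_component_singleton[of j "{i, j}" "\<lambda>_. lborel :: real measure"] by simp_all
  have cube: "{i, j} \<rightarrow>\<^sub>E {0..<1::real} \<in> sets ?M"
    by (intro sets_PiM_I_finite) auto
  have X_eq: "?X = ({i, j} \<rightarrow>\<^sub>E {0..<1}) \<inter> {x \<in> space ?M. real Q * x i + real k * x j \<in> circ_ball c \<rho>}
      \<inter> {x \<in> space ?M. real R * x i + real l * x j \<in> circ_ball c' \<rho>'}"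
    using sets.sets_into_space[OF cube] by blast
  have "{x \<in> space ?M. real Q * x i + real k * x j \<in> circ_ball c \<rho>} \<in> sets ?M"
    "{x \<in> space ?M. real R * x i + real l * x j \<in> circ_ball c' \<rho>'} \<in> sets ?M"
    using comp by measurable
  with cube have "?X \<in> sets ?M" unfolding X_eq by (intro sets.Int)
  then have "emeasure ?M ?X = (\<integral>\<^sup>+x. indicator ?X x \<partial>?M)" by simp
  also have "\<dots> = (\<integral>\<^sup>+x. h (x i) (x j) \<partial>?M)"
  proof (rule nn_integral_cong)
    fix x assume "x \<in> space ?M"
    then have "x \<in> {i, j} \<rightarrow>\<^sub>E {0..<1} \<longleftrightarrow> x i \<in> {0..<1} \<and> x j \<in> {0..<1}"
      by (auto simp: space_PiM PiE_iff)
    then show "indicator ?X x = h (x i) (x j)"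
      by (auto simp: h_def f_def g_def indicator_def)
  qed
  also have "\<dots> = (\<integral>\<^sup>+v. (\<integral>\<^sup>+u. h u v \<partial>lborel) \<partial>lborel)"
    by (rule nn_integral_PiM_two[OF assms(1) h_meas])
  also have "\<dots> = (\<integral>\<^sup>+v\<in>{0..<1}. (\<integral>\<^sup>+u\<in>{0..<1}. f (real Q * u + real k * v) * g (real R * u + real l * v) \<partial>lborel) \<partial>lborel)"
    unfolding h_def by (intro nn_integral_cong nn_integral_multc) measurable
  also have "\<dots> = (\<integral>\<^sup>+x\<in>{0..<1}. f x \<partial>lborel) * (\<integral>\<^sup>+x\<in>{0..<1}. g x \<partial>lborel)"
    using assms(2,3) by (intro periodic_nn_integral_independent) (auto simp: f_def g_def)
  also have "\<dots> = ennreal (ball_length \<rho> * ball_length \<rho>')"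
    by (simp add: f_def g_def circ_ball_length ennreal_mult)
  finally show ?thesis .
qed

text \<open>There are \<open>totient Q\<close> vectors \<open>(Q, k)\<close> for each norm
  \<open>Q\<close>, so the divergent series is the total measure of the sets. By pairwise
  independence only the diagonal exceeds the product \<open>S\<^sup>2\<close>, and by no more than
  \<open>S\<close>.\<close>

theorem approx_set_2_1_full:
  fixes cen :: "nat \<Rightarrow> nat \<Rightarrow> real" and rad :: "nat \<Rightarrow> real"
  assumes ns: "\<not> summable (\<lambda>k. real (totient (Suc k)) * ball_length (rad (Suc k)))"
  shows "emeasure (Pi\<^sub>M ({..<2} \<times> {..<1}) (\<lambda>_. lborel)) (approx_set 2 1 cen rad) = 1"
proof -
  let ?I = "{..<2} \<times> {..<1} :: (nat \<times> nat) set"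
  let ?M = "Pi\<^sub>M ?I (\<lambda>_. lborel) :: (nat \<times> nat \<Rightarrow> real) measure"
  have I: "?I = {(0, 0), (1, 0)}" by (auto simp: less_2_cases_iff)
  have ne: "(0::nat, 0::nat) \<noteq> (1, 0)" by simp
  define a where "a q = ball_length (rad q)" for q
  have a: "0 \<le> a q" "a q \<le> 1" for q by (simp_all add: a_def)
  define A where "A = (\<lambda>(Q, k). {x \<in> ?I \<rightarrow>\<^sub>E {0..<1}.
    real Q * x (0, 0) + real k * x (1, 0) \<in> circ_ball (cen Q 0) (rad Q)})"
  \<comment> \<open>The vectors \<open>(Q, k)\<close> with \<open>k \<le> Q\<close> coprime to \<open>Q\<close> have norm \<open>Q\<close> and are pairwise
    linearly independent.\<close>
  define P where "P = {(Q, k). Q > 0 \<and> k \<in> totatives Q}"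
  have A_sub: "A p \<subseteq> ?I \<rightarrow>\<^sub>E {0..<1}" for p by (auto simp: A_def split: prod.split)
  have A_sets: "A p \<in> sets ?M" for p
  proof -
    obtain Q k where p: "p = (Q, k)" by (cases p)
    have comp: "(\<lambda>x. x (0, 0)) \<in> borel_measurable ?M" "(\<lambda>x. x (1, 0)) \<in> borel_measurable ?M"
      using measurable_component_singleton[of "(0, 0)" ?I "\<lambda>_. lborel :: real measure"]
        measurable_component_singleton[of "(1, 0)" ?I "\<lambda>_. lborel :: real measure"] by simp_all
    have cube: "?I \<rightarrow>\<^sub>E {0..<1::real} \<in> sets ?M" by (intro sets_PiM_I_finite) auto
    have "A p = (?I \<rightarrow>\<^sub>E {0..<1})
      \<inter> {x \<in> space ?M. real Q * x (0, 0) + real k * x (1, 0) \<in> circ_ball (cen Q 0) (rad Q)}"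
      using sets.sets_into_space[OF cube] by (auto simp: A_def p)
    also have "\<dots> \<in> sets ?M"
      using comp by (intro sets.Int cube) measurable
    finally show ?thesis .
  qed
  have A_fm: "A p \<in> fmeasurable ?M" for p
    by (rule fmeasurableI2[OF half_open_cube(1) A_sub A_sets]) simp
  have A_measure: "measure ?M (A (Q, k)) = a Q" if "Q > 0" for Q k
  proof -
    \<comment> \<open>The measure of one set is the overlap with the trivial condition on \<open>x\<^sub>1\<close>.\<close>
    have all: "circ_ball 0 1 = UNIV"
    proof -
      have "\<bar>y - 0 - of_int \<lfloor>y\<rfloor>\<bar> < 1" for y :: real by linarith
      then show ?thesis unfolding circ_ball_def by blast
    qed
    have "emeasure ?M (A (Q, k)) = ennreal (a Q)"
      using emeasure_linear_form_Int[OF ne, of Q 0 k 1 "cen Q 0" "rad Q" 0 1] that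
      unfolding A_def I by (simp add: all a_def ball_length_def del: One_nat_def)
    then show ?thesis by (simp add: measure_def a)
  qed
  have Int_det: "measure ?M (A (Q, k) \<inter> A (R, l)) = a Q * a R" if "Q > 0" "R * k < Q * l" for Q k R l
  proof -
    have "A (Q, k) \<inter> A (R, l) = {x \<in> ?I \<rightarrow>\<^sub>E {0..<1}.
        real Q * x (0, 0) + real k * x (1, 0) \<in> circ_ball (cen Q 0) (rad Q) \<and>
        real R * x (0, 0) + real l * x (1, 0) \<in> circ_ball (cen R 0) (rad R)}"
      by (auto simp: A_def)
    then have "emeasure ?M (A (Q, k) \<inter> A (R, l)) = ennreal (a Q * a R)"
      using emeasure_linear_form_Int[OF ne, of Q R k l "cen Q 0" "rad Q" "cen R 0" "rad R"] that
      unfolding I by (simp add: a_def del: One_nat_def)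
    then show ?thesis by (simp add: measure_def a)
  qed
  have indep: "measure ?M (A p \<inter> A p') = a (fst p) * a (fst p')" if "p \<in> P" "p' \<in> P" "p \<noteq> p'" for p p'
  proof -
    obtain Q k R l where p: "p = (Q, k)" "p' = (R, l)" by (cases p, cases p')
    have pos: "Q > 0" "R > 0" and cop: "coprime k Q" "coprime l R"
      using that by (auto simp: P_def p totatives_def)
    \<comment> \<open>Equal cross products would make \<open>k/Q\<close> and \<open>l/R\<close> the
      same fraction, and both are in lowest terms.\<close>
    have "Q * l \<noteq> R * k"
    proof
      assume eq: "Q * l = R * k"
      then have "Q = R \<and> k = l"
        using coprime_crossproduct_nat[of Q k R l] cop by (simp add: coprime_commute)
      with that(3) show False by (simp add: p)
    qed
    then consider "R * k < Q * l" | "Q * l < R * k" by linarith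
    then show ?thesis
    proof cases
      case 1
      then show ?thesis using Int_det[of Q R k l] pos by (simp add: p)
    next
      case 2
      then show ?thesis using Int_det[of R Q l k] pos by (simp add: p Int_commute mult.commute)
    qed
  qed
  have "AE x in ?M. x \<in> ?I \<rightarrow>\<^sub>E {0..<1} \<longrightarrow> infinite {p \<in> P. x \<in> A p}"
  proof (rule AE_infinitely_often[where lev = fst])
    fix \<delta> :: real and N :: nat
    assume "\<delta> > 0"
    \<comment> \<open>Mass \<open>1 / \<delta>\<close> suffices: then
      \<open>S \<le> \<delta> * S\<^sup>2\<close> absorbs the diagonal.\<close>
    obtain L where L: "(\<Sum>k=N..<L. real (totient (Suc k)) * a (Suc k)) \<ge> 1 / \<delta>"
      using not_summable_tail_unbounded[OF _ ns, where N = N and K = "1 / \<delta>"] unfolding a_def by auto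
    define F where "F = Sigma {Suc N..<Suc L} totatives"
    have F: "finite F" "F \<subseteq> {p \<in> P. fst p \<ge> N}" by (auto simp: F_def P_def)
    have F_measure: "measure ?M (A p) = a (fst p)" if "p \<in> F" for p
      using that A_measure by (auto simp: F_def)
    define S where "S = (\<Sum>p\<in>F. a (fst p))"
    have "S = (\<Sum>Q=Suc N..<Suc L. \<Sum>k\<in>totatives Q. a Q)"
      unfolding S_def F_def by (subst sum.Sigma) (auto simp: case_prod_unfold)
    also have "\<dots> = (\<Sum>Q=Suc N..<Suc L. real (totient Q) * a Q)"
      by (simp add: totient_def)
    also have "\<dots> = (\<Sum>k=N..<L. real (totient (Suc k)) * a (Suc k))"
      by (rule sum.shift_bounds_Suc_ivl)
    finally have S: "S \<ge> 1 / \<delta>" using L by simp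
    have "S > 0" using \<open>\<delta> > 0\<close> by (intro less_le_trans[OF _ S]) simp
    \<comment> \<open>The conditional term pays for the diagonal, where the overlap is
      \<open>a (fst p)\<close> instead of its square.\<close>
    have "(\<Sum>p\<in>F. \<Sum>p'\<in>F. measure ?M (A p \<inter> A p'))
        \<le> (\<Sum>p\<in>F. \<Sum>p'\<in>F. a (fst p) * a (fst p') + (if p = p' then a (fst p) else 0))"
    proof (intro sum_mono)
      fix p p' assume p: "p \<in> F" "p' \<in> F"
      show "measure ?M (A p \<inter> A p') \<le> a (fst p) * a (fst p') + (if p = p' then a (fst p) else 0)"
      proof (cases "p = p'")
        case True
        then show ?thesis using F_measure p a by simp
      next
        case False
        moreover have "p \<in> P" "p' \<in> P" using p F by blast+
        ultimately show ?thesis using indep[of p p'] by simp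
      qed
    qed
    also have "\<dots> = S * S + S"
      using F(1) by (simp add: sum.distrib S_def sum_product)
    also have "\<dots> \<le> (1 + \<delta>) * S\<^sup>2"
    proof -
      have "1 * S \<le> (\<delta> * S) * S"
        using S \<open>\<delta> > 0\<close> \<open>S > 0\<close> by (intro mult_right_mono) (auto simp: field_simps)
      then show ?thesis by (simp add: power2_eq_square algebra_simps)
    qed
    finally have "measure ?M (\<Union>p\<in>F. A p) \<ge> 1 - \<delta>"
      using F(1) A_fm \<open>\<delta> > 0\<close> \<open>S > 0\<close> F_measure
      by (intro second_moment_union_ge[where S = S]) (auto simp: S_def)
    then show "\<exists>F. finite F \<and> F \<subseteq> {p \<in> P. fst p \<ge> N} \<and> measure ?M (\<Union>p\<in>F. A p) \<ge> 1 - \<delta>"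
      using F by blast
  next
    show "?I \<rightarrow>\<^sub>E {0..<1::real} \<in> fmeasurable ?M" "measure ?M (?I \<rightarrow>\<^sub>E {0..<1::real}) = 1"
      by (intro half_open_cube; simp)+
  qed (use A_sets A_sub in auto)
  then have "AE x in ?M. x \<in> ?I \<rightarrow>\<^sub>E {0..<1} \<longrightarrow> x \<in> approx_set 2 1 cen rad"
  proof (eventually_elim, intro impI)
    fix x assume x: "x \<in> ?I \<rightarrow>\<^sub>E {0..<1}"
      and "x \<in> ?I \<rightarrow>\<^sub>E {0..<1} \<longrightarrow> infinite {p \<in> P. x \<in> A p}"
    then have inf: "infinite {p \<in> P. x \<in> A p}" by blast
    define v where "v p = restrict (\<lambda>i. if i = 0 then int (fst p) else int (snd p)) {..<2::nat}" for p
    have v01: "v p 0 = int (fst p)" "v p 1 = int (snd p)" for p by (simp_all add: v_def)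
    have two: "{..<2::nat} = {0, 1}" by auto
    have norm: "sup_norm_int 2 (v p) = fst p" if "p \<in> P" for p
      using that by (auto simp: sup_norm_int_def two v01[unfolded One_nat_def] P_def totatives_def)
    have "inj v"
      by (rule injI) (metis v01 of_nat_eq_iff prod_eq_iff)
    show "x \<in> approx_set 2 1 cen rad"
    proof (rule approx_setI[OF x, where V = "v ` {p \<in> P. x \<in> A p}"])
      show "infinite (v ` {p \<in> P. x \<in> A p})"
        using inf \<open>inj v\<close> by (meson finite_imageD inj_on_subset subset_UNIV)
    next
      fix u assume "u \<in> v ` {p \<in> P. x \<in> A p}"
      then obtain p where p: "u = v p" "p \<in> P" "x \<in> A p" by auto
      have "u \<in> {..<2} \<rightarrow>\<^sub>E UNIV" by (simp add: p v_def)
      moreover have "\<exists>i<2. u i \<noteq> 0"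
        using p(2) by (intro exI[of _ 0]) (auto simp: p(1) v01 P_def)
      moreover have "real (fst p) * x (0, 0) + real (snd p) * x (1, 0) \<in> circ_ball (cen (fst p) 0) (rad (fst p))"
        using p(3) by (auto simp: A_def split: prod.splits)
      ultimately show "u \<in> {..<2} \<rightarrow>\<^sub>E UNIV \<and> (\<exists>i<2. u i \<noteq> 0) \<and>
        (\<forall>j<1. (\<Sum>i<2. of_int (u i) * x (i, j)) \<in> circ_ball (cen (sup_norm_int 2 u) j) (rad (sup_norm_int 2 u)))"
        unfolding p(1) norm[OF p(2)] two by (simp add: v01[unfolded One_nat_def])
    qed
  qed
  then show ?thesis by (rule emeasure_approx_set_eq_1I)
qed

section \<open>Reduction to the two cases\<close>

theorem mainTheorem14:
  fixes n m :: nat and \<epsilon> :: real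
    and cen :: "nat \<Rightarrow> nat \<Rightarrow> real" and rad :: "nat \<Rightarrow> real"
  assumes "n \<ge> 1" and "m \<ge> 1" and "n * m = 2" and "\<epsilon> > 0"
    and "\<not> summable (\<lambda>k. let q = Suc k in
            real q ^ (n - 1) * (real (totient q) / real q) powr (1 + \<epsilon>)
              * torus_ball_measure m (cen q) (rad q))"
  shows "emeasure (Pi\<^sub>M ({..<n} \<times> {..<m}) (\<lambda>_. lborel)) (approx_set n m cen rad) = 1"
proof -
  have "n dvd 2" using \<open>n * m = 2\<close> by (metis dvd_triv_left)
  then have "n = 1 \<or> n = 2" using two_is_prime_nat by (simp add: prime_nat_iff)
  then consider "n = 1" "m = 2" | "n = 2" "m = 1" using \<open>n * m = 2\<close> by auto
  then show ?thesis
  proof cases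
    case 1
    \<comment> \<open>Here the weight \<open>q ^ (n - 1)\<close> is 1 and the ball has measure
      \<open>ball_length\<close> squared.\<close>
    then show ?thesis
      using approx_set_1_2_full[OF \<open>\<epsilon> > 0\<close>, of rad cen] assms(5)
      by (simp add: torus_ball_measure_eq)
  next
    case 2
    let ?f = "\<lambda>k. real (Suc k) * (real (totient (Suc k)) / real (Suc k)) powr (1 + \<epsilon>) * ball_length (rad (Suc k))"
    have "\<not> summable ?f"
      using assms(5) unfolding 2 torus_ball_measure_eq Let_def by simp
    \<comment> \<open>As \<open>w = \<phi>(q)/q\<close> is at most 1,
      \<open>q * w powr (1 + \<epsilon>)\<close> is at most \<open>q * w\<close>, which is
      \<open>\<phi>(q)\<close>; divergence passes to the larger series.\<close>
    moreover have "norm (?f k) \<le> real (totient (Suc k)) * ball_length (rad (Suc k))" for k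
    proof -
      define w where "w = real (totient (Suc k)) / real (Suc k)"
      have w: "0 < w" "w \<le> 1"
        using totient_le[of "Suc k"] by (auto simp: w_def simp del: of_nat_Suc)
      have "w powr (1 + \<epsilon>) \<le> w powr 1"
        using w \<open>\<epsilon> > 0\<close> by (intro powr_mono') auto
      then have "real (Suc k) * w powr (1 + \<epsilon>) * ball_length (rad (Suc k)) \<le> real (Suc k) * w * ball_length (rad (Suc k))"
        using w by (intro mult_right_mono mult_left_mono) auto
      also have "real (Suc k) * w = real (totient (Suc k))" by (simp add: w_def)
      finally show ?thesis by (simp add: w_def abs_mult)
    qed
    ultimately have "\<not> summable (\<lambda>k. real (totient (Suc k)) * ball_length (rad (Suc k)))"
      using summable_comparison_test'[of "\<lambda>k. real (totient (Suc k)) * ball_length (rad (Suc k))" 0 ?f]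
      by blast
    with 2 show ?thesis using approx_set_2_1_full[of rad cen] by simp
  qed
qed

end
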